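(* If $\alpha$ is a nested word, then for every integer $t\ge 1$ there is a positive integer $f_{\alpha}(t)$ such that every graph in the path-star class $\mathcal R^{\alpha}$ of tree-width at least $f_{\alpha}(t)$ contains a $t$-sail as an induced subgraph.
   Context: $\mathbb N=\{1,2,3,\dots\}$. A word is a finite or infinite sequence of letters; letters are natural numbers, and $\alpha_j$ is the $j$-th letter of $\alpha$. For a word $\alpha$ over an alphabet $\mathcal A$ and $\mathcal S\subseteq\mathcal A$, $\alpha^{\mathcal S}$ denotes the word obtained from $\alpha$ by deleting all letters not in $\mathcal S$ (keeping the order of the remaining letters). Branched words: a word $\alpha$ over an alphabet $\mathcal A\subseteq\mathbb N$ is branched, with base set $\mathcal B$ and branch sets $\mathcal H_1,\mathcal H_2,\dots$, if $\mathcal A$ is partitioned into a finite base set $\mathcal B$ and (finitely or infinitely many) branch sets $\mathcal H_1,\mathcal H_2,\dots$, each finite or infinite and ordered by the order inherited from $\mathbb N$, such that in $\alpha$: a base letter can appear immediately after any other letter; the first (smallest) letter of a branch set can appear only immediately after a base letter (or as the first letter of the word); any other letter of a branch set $\mathcal H_i$ can appear only immediately after the letter preceding it in the order of $\mathcal H_i$. Nested words: let $\alpha$ be an infinite branched word over an infinite alphabet $\mathcal A\subseteq\mathbb N$ with base set $\mathcal B_\alpha$ and branch sets $\mathcal H^{\alpha}_1,\mathcal H^{\alpha}_2,\dots$, in which each letter of $\mathcal A$ appears infinitely many times. For a positive integer $\mathfrak b$, $\alpha$ is $\mathfrak b$-nested if every subset $\mathcal S\subseteq\mathcal A$ can be partitioned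 into a base set $\mathcal B_{\mathcal S}$ and ordered (possibly empty) branch sets $\mathcal H^{\mathcal S}_1,\mathcal H^{\mathcal S}_2,\dots$ such that $|\mathcal B_{\mathcal S}|\le\mathfrak b$, $\alpha^{\mathcal S}$ is a branched word with base set $\mathcal B_{\mathcal S}$ and these branch sets, and $\mathcal H^{\mathcal S}_i\subseteq\mathcal H^{\alpha}_i$ with the same ordering for each $i$. A word is nested if it is $\mathfrak b$-nested for some positive integer $\mathfrak b$. Path-star classes: the infinite graph $R^{\alpha}=(V_P\cup V_S,\;E_P\cup E_S)$ has path-vertices $V_P=\{p_j: j\in\mathbb N\}$, star-vertices $V_S=\{s_i: i\in\mathbb N\}$, path edges $E_P=\{p_jp_{j+1}: j\in\mathbb N\}$ and star edges $E_S=\{p_js_{\alpha_j}: j\in\mathbb N\}$. $\mathcal R^{\alpha}$ is the class of all finite induced subgraphs of $R^{\alpha}$ (up to isomorphism). $t$-sails: a finite graph $(V,E)$ is a path-star graph if $E$ can be partitioned into $E_P$ and $E_S$ such that $(V,E_P)$ is a forest of paths and $(V,E_S)$ is a forest of stars (isolated vertices allowed as trivial components). A path-star graph $(V,E_P\cup E_S)$ is a $t$-sail if there is a set $V_S=\{s_1,\dots,s_t\}\subseteq V$ of $t$ vertices such that: no edge in $E_P$ is incident with a vertex in $V_S$; the graph $(V\setminus V_S,E_P)$ has exactly $t$ components $P_1,\dots,P_t$, all paths; and for all $1\le i\le j\le t$ there exists a vertex $v$ of $P_i$ with $s_jv\in E_S$. *)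

theory Defs
  imports Main "HOL-Library.Infinite_Set" "HOL-Library.Extended_Nat" "HOL-Library.Disjoint_Sets"
begin

text \<open>Positions and letters range over the type \<open>nat\<close>, which plays the role of
  $\{1,2,3,\dots\}$: position \<open>j\<close> here is position $j+1$ in the usual numbering.\<close>

section \<open>Words\<close>

datatype lword = Fin_Word "nat list" | Inf_Word "nat \<Rightarrow> nat"

primrec word_length :: "lword \<Rightarrow> enat" where
  "word_length (Fin_Word xs) = enat (length xs)"
| "word_length (Inf_Word \<alpha>) = \<infinity>"

primrec letter :: "lword \<Rightarrow> nat \<Rightarrow> nat" where
  "letter (Fin_Word xs) j = xs ! j"
| "letter (Inf_Word \<alpha>) j = \<alpha> j"

definition word_over :: "lword \<Rightarrow> nat set \<Rightarrow> bool" where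
  "word_over w A \<longleftrightarrow> (\<forall>j. enat j < word_length w \<longrightarrow> letter w j \<in> A)"

text \<open>\<open>keep_letters S w\<close> deletes from \<open>w\<close> all letters outside \<open>S\<close>; for an infinite word the
  result is finite or infinite according to how many positions survive.\<close>

primrec keep_letters :: "nat set \<Rightarrow> lword \<Rightarrow> lword" where
  "keep_letters S (Fin_Word xs) = Fin_Word (filter (\<lambda>x. x \<in> S) xs)"
| "keep_letters S (Inf_Word \<alpha>) =
     (if infinite {j. \<alpha> j \<in> S}
      then Inf_Word (\<lambda>n. \<alpha> (enumerate {j. \<alpha> j \<in> S} n))
      else Fin_Word (map \<alpha> (sorted_list_of_set {j. \<alpha> j \<in> S})))"

definition first_letter_of :: "nat set \<Rightarrow> nat \<Rightarrow> bool" where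
  "first_letter_of H x \<longleftrightarrow> x \<in> H \<and> (\<forall>y\<in>H. x \<le> y)"

definition precedes_in :: "nat set \<Rightarrow> nat \<Rightarrow> nat \<Rightarrow> bool" where
  "precedes_in H x y \<longleftrightarrow> x \<in> H \<and> y \<in> H \<and> x < y \<and> \<not> (\<exists>z\<in>H. x < z \<and> z < y)"

text \<open>Branch sets may be empty, so a family indexed by \<open>nat\<close> covers finitely and
  infinitely many of them.\<close>

definition base_branch_partition :: "nat set \<Rightarrow> nat set \<Rightarrow> (nat \<Rightarrow> nat set) \<Rightarrow> bool" where
  "base_branch_partition A B H \<longleftrightarrow>
     A = B \<union> (\<Union>i. H i) \<and> (\<forall>i. B \<inter> H i = {}) \<and> disjoint_family H"

text \<open>Base letters are unrestricted; in particular a base letter may follow itself.\<close>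

definition branched_word :: "lword \<Rightarrow> nat set \<Rightarrow> nat set \<Rightarrow> (nat \<Rightarrow> nat set) \<Rightarrow> bool" where
  "branched_word w A B H \<longleftrightarrow>
     word_over w A \<and> base_branch_partition A B H \<and> finite B \<and>
     (\<forall>i j. enat j < word_length w \<and> letter w j \<in> H i \<longrightarrow>
        (if first_letter_of (H i) (letter w j)
         then j = 0 \<or> letter w (j - 1) \<in> B
         else j > 0 \<and> precedes_in (H i) (letter w (j - 1)) (letter w j)))"

definition nested_with :: "nat \<Rightarrow> (nat \<Rightarrow> nat) \<Rightarrow> nat set \<Rightarrow> nat set \<Rightarrow> (nat \<Rightarrow> nat set) \<Rightarrow> bool" where
  "nested_with b \<alpha> A B H \<longleftrightarrow>
     infinite A \<and> branched_word (Inf_Word \<alpha>) A B H \<and>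
     (\<forall>a\<in>A. infinite {j. \<alpha> j = a}) \<and>
     (\<forall>S\<subseteq>A. \<exists>BS HS. card BS \<le> b \<and>
        branched_word (keep_letters S (Inf_Word \<alpha>)) S BS HS \<and> (\<forall>i. HS i \<subseteq> H i))"

definition nested_word :: "(nat \<Rightarrow> nat) \<Rightarrow> bool" where
  "nested_word \<alpha> \<longleftrightarrow> (\<exists>b\<ge>1. \<exists>A B H. nested_with b \<alpha> A B H)"

section \<open>Simple graphs\<close>

type_synonym 'a ugraph = "'a set \<times> 'a set set"

abbreviation verts_of :: "'a ugraph \<Rightarrow> 'a set" where "verts_of \<equiv> fst"
abbreviation edges_of :: "'a ugraph \<Rightarrow> 'a set set" where "edges_of \<equiv> snd"

definition simple_graph :: "'a ugraph \<Rightarrow> bool" where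
  "simple_graph G \<longleftrightarrow> (\<forall>e\<in>edges_of G. e \<subseteq> verts_of G \<and> card e = 2)"

definition finite_graph :: "'a ugraph \<Rightarrow> bool" where
  "finite_graph G \<longleftrightarrow> simple_graph G \<and> finite (verts_of G)"

definition induced :: "'a ugraph \<Rightarrow> 'a set \<Rightarrow> 'a ugraph" where
  "induced G W = (W, {e \<in> edges_of G. e \<subseteq> W})"

definition graph_iso :: "'a ugraph \<Rightarrow> 'b ugraph \<Rightarrow> bool" where
  "graph_iso G H \<longleftrightarrow>
     (\<exists>h. bij_betw h (verts_of G) (verts_of H) \<and>
        (\<forall>u\<in>verts_of G. \<forall>v\<in>verts_of G. {u, v} \<in> edges_of G \<longleftrightarrow> {h u, h v} \<in> edges_of H))"

definition reachable_in :: "'a ugraph \<Rightarrow> ('a \<times> 'a) set" where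
  "reachable_in G = {(u, v). {u, v} \<in> edges_of G}\<^sup>*"

definition connected_graph :: "'a ugraph \<Rightarrow> bool" where
  "connected_graph G \<longleftrightarrow> verts_of G \<noteq> {} \<and>
     (\<forall>u\<in>verts_of G. \<forall>v\<in>verts_of G. (u, v) \<in> reachable_in G)"

definition graph_components :: "'a ugraph \<Rightarrow> 'a ugraph set" where
  "graph_components G =
     {induced G {v \<in> verts_of G. (u, v) \<in> reachable_in G} | u. u \<in> verts_of G}"

definition is_cycle :: "'a ugraph \<Rightarrow> 'a list \<Rightarrow> bool" where
  "is_cycle G xs \<longleftrightarrow> length xs \<ge> 3 \<and> distinct xs \<and>
     (\<forall>i. Suc i < length xs \<longrightarrow> {xs ! i, xs ! Suc i} \<in> edges_of G) \<and>
     {last xs, hd xs} \<in> edges_of G"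

definition is_tree :: "'a ugraph \<Rightarrow> bool" where
  "is_tree G \<longleftrightarrow> simple_graph G \<and> connected_graph G \<and> \<not> (\<exists>xs. is_cycle G xs)"

definition is_path_graph :: "'a ugraph \<Rightarrow> bool" where
  "is_path_graph G \<longleftrightarrow>
     (\<exists>xs. xs \<noteq> [] \<and> distinct xs \<and> verts_of G = set xs \<and>
        edges_of G = {{xs ! i, xs ! Suc i} | i. Suc i < length xs})"

text \<open>An isolated vertex is both a path and a star.\<close>

definition is_star_graph :: "'a ugraph \<Rightarrow> bool" where
  "is_star_graph G \<longleftrightarrow>
     (\<exists>c\<in>verts_of G. edges_of G = {{c, v} | v. v \<in> verts_of G - {c}})"

section \<open>Tree-width\<close>

text \<open>Finite trees with nodes in \<open>nat\<close> suffice up to isomorphism for finite graphs. The width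
  uses truncated subtraction, so the graph without vertices gets tree-width 0 instead of -1.\<close>

definition tree_decomposition :: "'a ugraph \<Rightarrow> nat ugraph \<Rightarrow> (nat \<Rightarrow> 'a set) \<Rightarrow> bool" where
  "tree_decomposition G T X \<longleftrightarrow>
     is_tree T \<and> finite (verts_of T) \<and>
     (\<Union>n\<in>verts_of T. X n) = verts_of G \<and>
     (\<forall>e\<in>edges_of G. \<exists>n\<in>verts_of T. e \<subseteq> X n) \<and>
     (\<forall>v\<in>verts_of G. connected_graph (induced T {n \<in> verts_of T. v \<in> X n}))"

definition decomposition_width :: "nat ugraph \<Rightarrow> (nat \<Rightarrow> 'a set) \<Rightarrow> nat" where
  "decomposition_width T X = Max ((\<lambda>n. card (X n)) ` verts_of T) - 1"

definition tree_width :: "'a ugraph \<Rightarrow> nat" where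
  "tree_width G = (LEAST k. \<exists>T X. tree_decomposition G T X \<and> decomposition_width T X = k)"

section \<open>Path-star classes and sails\<close>

datatype ps_vertex = Path_Vertex nat | Star_Vertex nat

definition R_graph :: "(nat \<Rightarrow> nat) \<Rightarrow> ps_vertex ugraph" where
  "R_graph \<alpha> =
     (range Path_Vertex \<union> range Star_Vertex,
      {{Path_Vertex j, Path_Vertex (Suc j)} | j. True} \<union>
      {{Path_Vertex j, Star_Vertex (\<alpha> j)} | j. True})"

definition path_star_class :: "(nat \<Rightarrow> nat) \<Rightarrow> 'a ugraph set" where
  "path_star_class \<alpha> =
     {G. finite_graph G \<and> (\<exists>W \<subseteq> verts_of (R_graph \<alpha>). finite W \<and> graph_iso G (induced (R_graph \<alpha>) W))}"

definition path_star_partition :: "'a ugraph \<Rightarrow> 'a set set \<Rightarrow> 'a set set \<Rightarrow> bool" where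
  "path_star_partition G EP ES \<longleftrightarrow>
     finite_graph G \<and> edges_of G = EP \<union> ES \<and> EP \<inter> ES = {} \<and>
     (\<forall>C\<in>graph_components (verts_of G, EP). is_path_graph C) \<and>
     (\<forall>C\<in>graph_components (verts_of G, ES). is_star_graph C)"

text \<open>The star vertices are numbered by \<open>s\<close>, the path components by \<open>P\<close>.\<close>

definition is_sail :: "nat \<Rightarrow> 'a ugraph \<Rightarrow> bool" where
  "is_sail t G \<longleftrightarrow>
     (\<exists>EP ES VS s P. path_star_partition G EP ES \<and>
        VS \<subseteq> verts_of G \<and> bij_betw s {1..t} VS \<and>
        (\<forall>e\<in>EP. e \<inter> VS = {}) \<and>
        bij_betw P {1..t} (graph_components (verts_of G - VS, EP)) \<and>
        (\<forall>i\<in>{1..t}. is_path_graph (P i)) \<and>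
        (\<forall>i j. 1 \<le> i \<and> i \<le> j \<and> j \<le> t \<longrightarrow> (\<exists>v\<in>verts_of (P i). {s j, v} \<in> ES)))"

definition has_induced_sail :: "nat \<Rightarrow> 'a ugraph \<Rightarrow> bool" where
  "has_induced_sail t G \<longleftrightarrow> (\<exists>W\<subseteq>verts_of G. is_sail t (induced G W))"

end

theory Submission
  imports Defs
begin

text \<open>A graph of the class consists of a finite set of positions of the path and a finite set \<open>S\<close> of
star letters; its path components read factors of the word, and a letter of \<open>S\<close> that is read is
an edge to its star.

Nestedness can be used repeatedly. Let \<open>K 0\<close> be the base of \<open>S\<close>, let \<open>K 1\<close> be the base
of \<open>S - K 0\<close>, and so on, up to \<open>K (t - 1)\<close>; each has at most \<open>b\<close> letters. A stretch of
positions on which no letter of \<open>K k\<close> is read cannot switch between branches of what is left of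
\<open>S\<close>, so it reads consecutive letters of a single branch, and this remains true when further
letters are deleted (\<open>run_within_branch\<close>).

Suppose that many separated intervals of the path each meet all of \<open>K 0, ..., K (t - 1)\<close>. There
are at most \<open>b ^ t\<close> choices of one letter from each base, so \<open>t\<close> of these intervals meet the
same \<open>t\<close> letters (\<open>common_transversal\<close>), and these paths and stars are a sail
(\<open>separated_intervals_give_sail\<close>). Otherwise boundedly many positions hit all such intervals
(\<open>separated_intervals_or_hitting_set\<close>). Delete these positions and the stars of all the bases.
Each component of the path now avoids some base, and hence reads a run of consecutive letters of
a branch.

Give the remaining letters ranks such that consecutive letters of a branch have consecutive ranks.
If \<open>t\<close> separated intervals cover the same \<open>t\<close> consecutive ranks, they again form a sail with
these stars. If not, fewer than \<open>t\<close> components cover any given \<open>t\<close> consecutive ranks, and the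
graph can be swept in the order of the ranks with bags of at most \<open>3 * t\<close> vertices
(\<open>sweep_key_exists\<close>). This yields a path decomposition whose width, together with the deleted
vertices, is bounded in terms of \<open>b\<close> and \<open>t\<close> (\<open>tree_width_le_by_sweep\<close>).\<close>

section \<open>Connectivity and components\<close>

lemma reachable_in_sym: "(u, v) \<in> reachable_in G \<Longrightarrow> (v, u) \<in> reachable_in G"
proof -
  have "sym {(u, v). {u, v} \<in> edges_of G}"
    by (auto simp: sym_def insert_commute)
  then show "(u, v) \<in> reachable_in G \<Longrightarrow> (v, u) \<in> reachable_in G"
    unfolding reachable_in_def by (meson sym_rtrancl symD)
qed

lemma reachable_in_step: "(u, v) \<in> reachable_in G \<Longrightarrow> {v, w} \<in> edges_of G \<Longrightarrow> (u, w) \<in> reachable_in G"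
  unfolding reachable_in_def by (simp add: rtrancl.rtrancl_into_rtrancl)

lemma reachable_in_refl: "(u, u) \<in> reachable_in G"
  unfolding reachable_in_def by simp

lemma connected_graph_if_root:
  assumes "c \<in> verts_of G" "\<And>v. v \<in> verts_of G \<Longrightarrow> (c, v) \<in> reachable_in G"
  shows "connected_graph G"
  unfolding connected_graph_def
proof (intro conjI ballI)
  fix u v assume "u \<in> verts_of G" "v \<in> verts_of G"
  then have "(u, c) \<in> reachable_in G" "(c, v) \<in> reachable_in G"
    using reachable_in_sym[OF assms(2)] assms(2) by simp_all
  then show "(u, v) \<in> reachable_in G"
    unfolding reachable_in_def by simp
qed (use assms(1) in auto)

text \<open>To know the components of a graph it suffices to exhibit the right partition: no edge leaves a
block, and each block is reachable from one of its vertices.\<close>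

lemma graph_components_eqI:
  assumes cover: "\<Union>\<C> = V"
    and disj: "\<And>C D. C \<in> \<C> \<Longrightarrow> D \<in> \<C> \<Longrightarrow> C \<inter> D \<noteq> {} \<Longrightarrow> C = D"
    and edges: "\<And>e. e \<in> E \<Longrightarrow> \<exists>C\<in>\<C>. e \<subseteq> C"
    and conn: "\<And>C. C \<in> \<C> \<Longrightarrow> \<exists>c\<in>C. \<forall>v\<in>C. (c, v) \<in> reachable_in (V, E)"
  shows "graph_components (V, E) = induced (V, E) ` \<C>"
proof -
  have class_eq: "{v \<in> V. (u, v) \<in> reachable_in (V, E)} = C" if C: "C \<in> \<C>" "u \<in> C" for u C
  proof
    show "C \<subseteq> {v \<in> V. (u, v) \<in> reachable_in (V, E)}"
    proof
      fix v assume "v \<in> C"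
      obtain c where "\<forall>v\<in>C. (c, v) \<in> reachable_in (V, E)" using conn[OF C(1)] by blast
      then have "(u, c) \<in> reachable_in (V, E)" "(c, v) \<in> reachable_in (V, E)"
        using \<open>v \<in> C\<close> C(2) reachable_in_sym[of c u] by simp_all
      then have "(u, v) \<in> reachable_in (V, E)" unfolding reachable_in_def by simp
      then show "v \<in> {v \<in> V. (u, v) \<in> reachable_in (V, E)}" using cover C(1) \<open>v \<in> C\<close> by auto
    qed
    have "v \<in> C" if "(u, v) \<in> reachable_in (V, E)" for v
      using that unfolding reachable_in_def
    proof (induction rule: rtrancl_induct)
      case base
      show ?case by (fact C(2))
    next
      case (step y z)
      then have "{y, z} \<in> E" by simp
      from edges[OF this] obtain D where D: "D \<in> \<C>" "{y, z} \<subseteq> D" by blast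
      then have "C = D" using disj[OF C(1) D(1)] step by auto
      then show ?case using D by auto
    qed
    then show "{v \<in> V. (u, v) \<in> reachable_in (V, E)} \<subseteq> C" by blast
  qed
  show ?thesis
  proof
    show "graph_components (V, E) \<subseteq> induced (V, E) ` \<C>"
    proof
      fix K assume "K \<in> graph_components (V, E)"
      then obtain u where u: "u \<in> V" "K = induced (V, E) {v \<in> V. (u, v) \<in> reachable_in (V, E)}"
        by (auto simp: graph_components_def)
      then obtain C where "C \<in> \<C>" "u \<in> C" using cover by auto
      then show "K \<in> induced (V, E) ` \<C>" using u class_eq by auto
    qed
    show "induced (V, E) ` \<C> \<subseteq> graph_components (V, E)"
    proof
      fix K assume "K \<in> induced (V, E) ` \<C>"
      then obtain C where C: "C \<in> \<C>" "K = induced (V, E) C" by blast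
      obtain c where "c \<in> C" using conn[OF C(1)] by blast
      then have "K = induced (V, E) {v \<in> V. (c, v) \<in> reachable_in (V, E)}" "c \<in> V"
        using class_eq[OF C(1)] C cover by auto
      then show "K \<in> graph_components (V, E)"
        unfolding graph_components_def by auto
    qed
  qed
qed

section \<open>Bounding tree-width by a sweep through the vertices\<close>

definition path_on :: "nat \<Rightarrow> nat ugraph" where
  "path_on M = ({..M}, {{n, Suc n} | n. n < M})"

text \<open>The hypothesis says that the nodes carrying a vertex form an interval with left end \<open>a\<close>;
this is how the connectivity condition of a tree decomposition is met below.\<close>

lemma path_on_interval_connected:
  assumes "N \<subseteq> {..M}" "a \<in> N" "\<And>i. i \<in> N \<Longrightarrow> a \<le> i \<and> {a..i} \<subseteq> N"
  shows "connected_graph (induced (path_on M) N)"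
proof (rule connected_graph_if_root)
  show "a \<in> verts_of (induced (path_on M) N)"
    using assms(2) by (simp add: induced_def)
next
  fix i assume "i \<in> verts_of (induced (path_on M) N)"
  then have iN: "i \<in> N" by (simp add: induced_def)
  have "(a, i) \<in> reachable_in (induced (path_on M) N)"
    if "a \<le> i" "{a..i} \<subseteq> N"
    using that
  proof (induction i rule: dec_induct)
    case base
    show ?case by (rule reachable_in_refl)
  next
    case (step n)
    have "{n, Suc n} \<subseteq> N" using step by auto
    moreover have "n < M" using \<open>{n, Suc n} \<subseteq> N\<close> assms(1) by auto
    ultimately have "{n, Suc n} \<in> edges_of (induced (path_on M) N)"
      by (auto simp: induced_def path_on_def)
    moreover have "(a, n) \<in> reachable_in (induced (path_on M) N)"
      using step by (meson atLeastatMost_subset_iff le_SucI order_refl subset_trans)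
    ultimately show ?case by (rule reachable_in_step[rotated])
  qed
  then show "(a, i) \<in> reachable_in (induced (path_on M) N)"
    using assms(3)[OF iN] by auto
qed

text \<open>A cycle would have a largest vertex, whose two neighbours on the cycle would both be its
predecessor.\<close>

lemma path_on_is_tree: "is_tree (path_on M)"
  unfolding is_tree_def
proof (intro conjI)
  show "simple_graph (path_on M)"
    by (auto simp: simple_graph_def path_on_def)
  have "induced (path_on M) {..M} = path_on M"
    by (auto simp: induced_def path_on_def)
  then show "connected_graph (path_on M)"
    using path_on_interval_connected[of "{..M}" M 0] by auto
  show "\<not> (\<exists>xs. is_cycle (path_on M) xs)"
  proof
    assume "\<exists>xs. is_cycle (path_on M) xs"
    then obtain xs where cyc: "is_cycle (path_on M) xs" by blast
    define n where "n = length xs"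
    have n3: "n \<ge> 3" and dist: "distinct xs" using cyc by (auto simp: is_cycle_def n_def)
    have ne: "xs \<noteq> []" using n3 by (auto simp: n_def)
    have edge: "{xs ! i, xs ! (Suc i mod n)} \<in> edges_of (path_on M)" if "i < n" for i
    proof (cases "Suc i < n")
      case True
      then show ?thesis using cyc by (auto simp: is_cycle_def n_def)
    next
      case False
      then have "Suc i = n" using that by simp
      then have "i = n - 1" by simp
      moreover have "xs ! (n - 1) = last xs" "xs ! 0 = hd xs"
        using ne by (simp_all add: last_conv_nth hd_conv_nth n_def)
      ultimately show ?thesis using cyc \<open>Suc i = n\<close> by (auto simp: is_cycle_def)
    qed
    have adj: "xs ! i = Suc (xs ! j) \<or> xs ! j = Suc (xs ! i)" if "{xs ! i, xs ! j} \<in> edges_of (path_on M)" for i j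
      using that by (auto simp: path_on_def doubleton_eq_iff)
    have "Max (set xs) \<in> set xs" using ne by simp
    then obtain i where i: "i < n" "xs ! i = Max (set xs)"
      unfolding n_def in_set_conv_nth by blast
    have le: "xs ! j \<le> xs ! i" if "j < n" for j
      using that i(2) by (auto simp: n_def)
    define j where "j = Suc i mod n"
    define k where "k = (if i = 0 then n - 1 else i - 1)"
    have jk: "j < n" "k < n" using n3 i by (auto simp: j_def k_def)
    have kmod: "Suc k mod n = i" using n3 i by (auto simp: k_def)
    have "xs ! i = Suc (xs ! j)"
      using adj[OF edge[OF i(1)]] le[OF jk(1)] by (auto simp: j_def)
    moreover have "xs ! i = Suc (xs ! k)"
      using adj[OF edge[OF jk(2)]] le[OF jk(2)] unfolding kmod by auto
    ultimately have "xs ! j = xs ! k" by simp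
    then have "j = k" using dist jk by (simp add: nth_eq_iff_index_eq n_def)
    then show False
      using n3 i by (cases "Suc i = n") (auto simp: j_def k_def split: if_splits)
  qed
qed

text \<open>Think of \<open>v\<close> as being visited at time \<open>key v\<close>. The bag at time \<open>i\<close> holds what is visited
at that moment and those earlier vertices that still wait for a neighbour.\<close>

definition sweep_bag :: "'a ugraph \<Rightarrow> 'a set \<Rightarrow> ('a \<Rightarrow> nat) \<Rightarrow> nat \<Rightarrow> 'a set" where
  "sweep_bag G V key i =
     {v \<in> V. key v \<le> i \<and> (key v = i \<or> (\<exists>u \<in> V. i \<le> key u \<and> {u, v} \<in> edges_of G))}"

text \<open>The bags of the sweep form a path decomposition of the graph without \<open>Z\<close>: a vertex stays in the
bags from its own time up to that of its last neighbour, and an edge lies in the bag of its later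
end. Adding \<open>Z\<close> to every bag takes care of the deleted vertices.\<close>

lemma tree_width_le_by_sweep:
  fixes key :: "'a \<Rightarrow> nat"
  assumes G: "finite_graph G" and Z: "Z \<subseteq> verts_of G"
    and bag: "\<And>i. card (sweep_bag G (verts_of G - Z) key i) \<le> k"
  shows "tree_width G \<le> card Z + k"
proof -
  let ?V = "verts_of G" and ?E = "edges_of G"
  have finV: "finite ?V" and simple: "simple_graph G" using G by (auto simp: finite_graph_def)
  define bdry where bdry_eq: "bdry = sweep_bag G (?V - Z) key"
  have bdry_def: "bdry i = {v \<in> ?V - Z. key v \<le> i \<and>
      (key v = i \<or> (\<exists>u \<in> ?V - Z. i \<le> key u \<and> {u, v} \<in> ?E))}" for i
    by (simp add: bdry_eq sweep_bag_def)
  define X where "X i = Z \<union> bdry i" for i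
  define M where "M = Max (insert 0 (key ` ?V))"
  have key_le: "key v \<le> M" if "v \<in> ?V" for v
    using that finV by (simp add: M_def)
  have own_bag: "v \<in> X (key v)" if "v \<in> ?V" for v
    using that by (auto simp: X_def bdry_def)
  have "tree_decomposition G (path_on M) X"
    unfolding tree_decomposition_def
  proof (intro conjI ballI)
    show "is_tree (path_on M)" by (rule path_on_is_tree)
    show "finite (verts_of (path_on M))" by (simp add: path_on_def)
    show "(\<Union>n\<in>verts_of (path_on M). X n) = ?V"
    proof
      show "(\<Union>n\<in>verts_of (path_on M). X n) \<subseteq> ?V" using Z by (auto simp: X_def bdry_def)
      show "?V \<subseteq> (\<Union>n\<in>verts_of (path_on M). X n)"
      proof
        fix v assume "v \<in> ?V"
        then show "v \<in> (\<Union>n\<in>verts_of (path_on M). X n)"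
          using own_bag[of v] key_le[of v] by (auto simp: path_on_def)
      qed
    qed
  next
    fix e assume e: "e \<in> ?E"
    then have "e \<subseteq> ?V" "card e = 2" using simple by (auto simp: simple_graph_def)
    then obtain u v where uv: "e = {u, v}" "u \<in> ?V" "v \<in> ?V"
      by (auto simp: card_2_iff)
    have later_bag: "{x, y} \<subseteq> X (key y)" if "x \<in> ?V" "y \<in> ?V" "key x \<le> key y" "y \<notin> Z" "{x, y} \<in> ?E" for x y
      using that by (auto simp: X_def bdry_def insert_commute)
    have "\<exists>n \<le> M. e \<subseteq> X n"
    proof (cases "u \<in> Z \<or> v \<in> Z")
      case True
      then show ?thesis
      proof
        assume "u \<in> Z"
        then show ?thesis using uv own_bag[of v] key_le[of v] by (auto simp: X_def)
      next
        assume "v \<in> Z"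
        then show ?thesis using uv own_bag[of u] key_le[of u] by (auto simp: X_def)
      qed
    next
      case False
      then have "e \<subseteq> X (key v) \<or> e \<subseteq> X (key u)"
        using uv e later_bag[of u v] later_bag[of v u]
        by (cases "key u \<le> key v") (auto simp: insert_commute)
      then show ?thesis using key_le uv by blast
    qed
    then show "\<exists>n\<in>verts_of (path_on M). e \<subseteq> X n" by (auto simp: path_on_def)
  next
    fix v assume v: "v \<in> ?V"
    let ?N = "{n \<in> verts_of (path_on M). v \<in> X n}"
    show "connected_graph (induced (path_on M) ?N)"
    proof (cases "v \<in> Z")
      case True
      then show ?thesis
        by (intro path_on_interval_connected[of _ _ 0]) (auto simp: path_on_def X_def)
    next
      case False
      show ?thesis
      proof (rule path_on_interval_connected[of _ _ "key v"])
        fix i assume "i \<in> ?N"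
        then have i: "i \<le> M" "v \<in> bdry i" using False by (auto simp: path_on_def X_def)
        have "v \<in> bdry j" if "key v \<le> j" "j \<le> i" for j
        proof (cases "key v = i")
          case True
          then show ?thesis using i that by (auto simp: bdry_def)
        next
          case False
          then obtain u where u: "u \<in> ?V - Z" "i \<le> key u" "{u, v} \<in> ?E"
            using i(2) by (auto simp: bdry_def)
          then have "j \<le> key u" using that by simp
          then show ?thesis using i(2) that u unfolding bdry_def by blast
        qed
        then show "key v \<le> i \<and> {key v..i} \<subseteq> ?N"
          using i by (auto simp: path_on_def X_def bdry_def)
      qed (use own_bag[OF v] key_le[OF v] in \<open>auto simp: path_on_def\<close>)
    qed
  qed
  then have "tree_width G \<le> decomposition_width (path_on M) X"
    unfolding tree_width_def by (intro Least_le) blast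
  also have "\<dots> \<le> card Z + k"
  proof -
    have "card (X i) \<le> card Z + k" for i
      using card_Un_le[of Z "bdry i"] bag[of i] unfolding X_def bdry_eq by linarith
    then have "Max ((\<lambda>n. card (X n)) ` verts_of (path_on M)) \<le> card Z + k"
      by (intro Max.boundedI) (auto simp: path_on_def)
    then show ?thesis unfolding decomposition_width_def by linarith
  qed
  finally show ?thesis .
qed

section \<open>Sails from separated intervals\<close>

text \<open>A pair stands for the closed interval between its components. A gap of at least one position
between two intervals makes them non-adjacent in the path, so that they are different components
of the subgraph that they induce.\<close>

definition separated_intervals :: "(nat \<times> nat) set \<Rightarrow> bool" where
  "separated_intervals F \<longleftrightarrow>
     (\<forall>I\<in>F. fst I \<le> snd I) \<and>
     (\<forall>I\<in>F. \<forall>K\<in>F. I \<noteq> K \<longrightarrow> snd I + 1 < fst K \<or> snd K + 1 < fst I)"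

lemma separated_intervals_subset: "separated_intervals F \<Longrightarrow> F' \<subseteq> F \<Longrightarrow> separated_intervals F'"
  unfolding separated_intervals_def by blast

lemma separated_intervals_near:
  assumes "separated_intervals F" "I \<in> F" "K \<in> F"
    and "i \<in> {fst I..snd I}" "j \<in> {fst K..snd K}" "j = i \<or> j = Suc i"
  shows "I = K"
proof (rule ccontr)
  assume "I \<noteq> K"
  then have "snd I + 1 < fst K \<or> snd K + 1 < fst I"
    using assms(1-3) unfolding separated_intervals_def by blast
  then show False using assms(4-6) by auto
qed

lemma is_sailI:
  assumes "path_star_partition G EP ES" "VS \<subseteq> verts_of G" "bij_betw s {1..t} VS"
    and "\<And>e. e \<in> EP \<Longrightarrow> e \<inter> VS = {}"
    and "bij_betw P {1..t} (graph_components (verts_of G - VS, EP))"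
    and "\<And>i. i \<in> {1..t} \<Longrightarrow> is_path_graph (P i)"
    and "\<And>i j. i \<in> {1..t} \<Longrightarrow> j \<in> {1..t} \<Longrightarrow> \<exists>v\<in>verts_of (P i). {s j, v} \<in> ES"
  shows "is_sail t G"
proof -
  have "\<forall>i j. 1 \<le> i \<and> i \<le> j \<and> j \<le> t \<longrightarrow> (\<exists>v\<in>verts_of (P i). {s j, v} \<in> ES)"
    using assms(7) by simp
  then show ?thesis
    unfolding is_sail_def
    by (intro exI[of _ EP] exI[of _ ES] exI[of _ VS] exI[of _ s] exI[of _ P] conjI ballI assms)
qed

text \<open>The maps \<open>p\<close> and \<open>s\<close> place positions and letters in an arbitrary graph, which spares
transporting sails along isomorphisms. The sail obtained is complete: each of the \<open>t\<close> paths
is adjacent to each of the \<open>t\<close> stars, so any numbering of them will do.\<close>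

lemma separated_intervals_give_sail:
  fixes p s :: "nat \<Rightarrow> 'a" and \<alpha> :: "nat \<Rightarrow> nat"
  defines "Q \<equiv> \<lambda>F. \<Union>I\<in>F. {fst I..snd I}"
  assumes G: "simple_graph G" and sub: "p ` Q F \<union> s ` T \<subseteq> verts_of G"
    and inj: "inj_on p (Q F)" "inj_on s T" "p ` Q F \<inter> s ` T = {}"
    and pp: "\<And>i j. i \<in> Q F \<Longrightarrow> j \<in> Q F \<Longrightarrow> {p i, p j} \<in> edges_of G \<longleftrightarrow> j = Suc i \<or> i = Suc j"
    and ps: "\<And>i a. i \<in> Q F \<Longrightarrow> a \<in> T \<Longrightarrow> {p i, s a} \<in> edges_of G \<longleftrightarrow> \<alpha> i = a"
    and ss: "\<And>a c. a \<in> T \<Longrightarrow> c \<in> T \<Longrightarrow> {s a, s c} \<notin> edges_of G"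
    and F: "finite F" "card F = t" "separated_intervals F"
    and T: "finite T" "card T = t" "\<And>I. I \<in> F \<Longrightarrow> T \<subseteq> \<alpha> ` {fst I..snd I}"
  shows "has_induced_sail t G"
proof -
  let ?Q = "Q F"
  have Q_iff: "i \<in> ?Q \<longleftrightarrow> (\<exists>I\<in>F. i \<in> {fst I..snd I})" for i by (auto simp: Q_def)
  have in_Q: "i \<in> ?Q" if "I \<in> F" "fst I \<le> i" "i \<le> snd I" for i I using that by (auto simp: Q_iff)
  have finQ: "finite ?Q" using F by (auto simp: Q_def)
  have le: "fst I \<le> snd I" if "I \<in> F" for I using F(3) that by (auto simp: separated_intervals_def)
  define W where "W = p ` ?Q \<union> s ` T"
  define EP where "EP = {{p i, p (Suc i)} | i. i \<in> ?Q \<and> Suc i \<in> ?Q}"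
  define ES where "ES = {{p i, s (\<alpha> i)} | i. i \<in> ?Q \<and> \<alpha> i \<in> T}"
  define blk where "blk I = p ` {fst I..snd I}" for I
  have p_eq: "p i = p j \<longleftrightarrow> i = j" if "i \<in> ?Q" "j \<in> ?Q" for i j
    using inj(1) that by (auto simp: inj_on_def)
  have s_eq: "s a = s c \<longleftrightarrow> a = c" if "a \<in> T" "c \<in> T" for a c
    using inj(2) that by (auto simp: inj_on_def)
  have p_ne_s: "p i \<noteq> s a" "s a \<noteq> p i" if "i \<in> ?Q" "a \<in> T" for i a
    using inj(3) that by force+
  have edges_W: "edges_of (induced G W) = EP \<union> ES"
  proof
    show "edges_of (induced G W) \<subseteq> EP \<union> ES"
    proof
      fix e assume "e \<in> edges_of (induced G W)"
      then have e: "e \<in> edges_of G" "e \<subseteq> W" by (auto simp: induced_def)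
      then have "card e = 2" using G by (auto simp: simple_graph_def)
      then obtain x y where xy: "e = {x, y}" by (auto simp: card_2_iff)
      have mixed: "{p i, s a} \<in> ES" if "i \<in> ?Q" "a \<in> T" "{p i, s a} \<in> edges_of G" for i a
        using ps[of i a] that by (auto simp: ES_def)
      have pairs: "{p i, p j} \<in> EP" if "i \<in> ?Q" "j \<in> ?Q" "{p i, p j} \<in> edges_of G" for i j
        using pp[OF that(1,2)] that by (auto simp: EP_def insert_commute)
      have "x \<in> W" "y \<in> W" using e xy by auto
      then consider i j where "i \<in> ?Q" "j \<in> ?Q" "x = p i" "y = p j"
        | i a where "i \<in> ?Q" "a \<in> T" "x = p i" "y = s a"
        | i a where "i \<in> ?Q" "a \<in> T" "y = p i" "x = s a"
        | a c where "a \<in> T" "c \<in> T" "x = s a" "y = s c"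
        unfolding W_def by blast
      then show "e \<in> EP \<union> ES"
      proof cases
        case 1 then show ?thesis using pairs e xy by auto
      next
        case 2 then show ?thesis using mixed e xy by auto
      next
        case 3 then show ?thesis using mixed e xy by (auto simp: insert_commute)
      next
        case 4 then show ?thesis using ss e xy by auto
      qed
    qed
    show "EP \<union> ES \<subseteq> edges_of (induced G W)"
      using pp ps by (auto simp: induced_def EP_def ES_def W_def)
  qed
  have induced_W: "induced G W = (W, EP \<union> ES)"
    using edges_W by (auto simp: induced_def)
  have blk_sub: "blk I \<subseteq> p ` ?Q" if "I \<in> F" for I
    using that by (auto simp: blk_def Q_def)
  have blk_disj: "I = K" if IK: "I \<in> F" "K \<in> F" and meet: "blk I \<inter> blk K \<noteq> {}" for I K
  proof -
    obtain i j where ij: "i \<in> {fst I..snd I}" "j \<in> {fst K..snd K}" "p i = p j"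
      using meet unfolding blk_def by blast
    have "i \<in> ?Q" "j \<in> ?Q" using ij IK Q_iff by auto
    then have "i = j" using p_eq ij(3) by simp
    then show ?thesis using separated_intervals_near[OF F(3) IK ij(1,2)] by simp
  qed
  have blk_edge: "\<exists>I\<in>F. e \<subseteq> blk I" if e: "e \<in> EP" for e
  proof -
    obtain i where i: "e = {p i, p (Suc i)}" "i \<in> ?Q" "Suc i \<in> ?Q" using e by (auto simp: EP_def)
    obtain I K where IK: "I \<in> F" "K \<in> F" "i \<in> {fst I..snd I}" "Suc i \<in> {fst K..snd K}"
      using i Q_iff by blast
    then have "I = K" using separated_intervals_near[OF F(3) IK] by simp
    then have "e \<subseteq> blk I" using IK i(1) by (auto simp: blk_def)
    then show ?thesis using IK(1) by blast
  qed
  have blk_conn: "\<exists>c\<in>blk I. \<forall>v\<in>blk I. (c, v) \<in> reachable_in (V, EP)" if I: "I \<in> F" for I V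
  proof (intro bexI ballI)
    show "p (fst I) \<in> blk I" using le[OF I] by (auto simp: blk_def)
    fix v assume "v \<in> blk I"
    then obtain i where i: "v = p i" "fst I \<le> i" "i \<le> snd I" by (auto simp: blk_def)
    have "(p (fst I), p i) \<in> reachable_in (V, EP)" using i(2,3)
    proof (induction i rule: dec_induct)
      case base show ?case by (rule reachable_in_refl)
    next
      case (step n)
      have "n \<in> ?Q" "Suc n \<in> ?Q" using in_Q[OF I] step by auto
      then have "{p n, p (Suc n)} \<in> edges_of (V, EP)" unfolding EP_def snd_conv by blast
      moreover have "(p (fst I), p n) \<in> reachable_in (V, EP)" using step.IH step.prems by simp
      ultimately show ?case by (rule reachable_in_step[rotated])
    qed
    then show "(p (fst I), v) \<in> reachable_in (V, EP)" using i by simp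
  qed
  have blk_path: "is_path_graph (induced (V, EP) (blk I))" if I: "I \<in> F" for I V
  proof -
    let ?xs = "map p [fst I..<Suc (snd I)]"
    have memQ: "i \<in> ?Q" if "fst I \<le> i" "i \<le> snd I" for i
      using in_Q[OF I that] .
    have "inj_on p {fst I..snd I}" using memQ p_eq by (auto simp: inj_on_def)
    then have "distinct ?xs" by (simp add: distinct_map atLeastLessThanSuc_atLeastAtMost del: upt_Suc)
    moreover have "blk I = set ?xs"
      by (simp add: blk_def atLeastLessThanSuc_atLeastAtMost del: upt_Suc)
    moreover have "{e \<in> EP. e \<subseteq> blk I} = {{?xs ! k, ?xs ! Suc k} | k. Suc k < length ?xs}"
    proof (intro equalityI subsetI)
      fix e assume "e \<in> {e \<in> EP. e \<subseteq> blk I}"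
      then obtain i where i: "e = {p i, p (Suc i)}" "i \<in> ?Q" "Suc i \<in> ?Q" "p i \<in> blk I" "p (Suc i) \<in> blk I"
        unfolding EP_def by auto
      have in_I: "j \<in> {fst I..snd I}" if j: "j \<in> ?Q" "p j \<in> blk I" for j
      proof -
        obtain m where "m \<in> {fst I..snd I}" "p j = p m" using j(2) unfolding blk_def by blast
        then show ?thesis using p_eq[OF j(1) memQ, of m] by simp
      qed
      have "fst I \<le> i" "Suc i \<le> snd I" using in_I i by auto
      then have "e = {?xs ! (i - fst I), ?xs ! Suc (i - fst I)}" "Suc (i - fst I) < length ?xs"
        using i(1) by (auto simp: nth_append simp del: upt_Suc)
      then show "e \<in> {{?xs ! k, ?xs ! Suc k} | k. Suc k < length ?xs}" by blast
    next
      fix e assume "e \<in> {{?xs ! k, ?xs ! Suc k} | k. Suc k < length ?xs}"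
      then obtain k where k: "e = {?xs ! k, ?xs ! Suc k}" "Suc k < length ?xs" by blast
      then have e_eq: "e = {p (fst I + k), p (Suc (fst I + k))}" and k_le: "fst I + Suc k \<le> snd I"
        by (auto simp del: upt_Suc)
      have "fst I + k \<in> ?Q" "Suc (fst I + k) \<in> ?Q" using memQ k_le by simp_all
      then have "e \<in> EP" unfolding EP_def using e_eq by blast
      moreover have "e \<subseteq> blk I"
        using e_eq k_le by (auto simp: blk_def)
      ultimately show "e \<in> {e \<in> EP. e \<subseteq> blk I}" by simp
    qed
    moreover have "?xs \<noteq> []" using le[OF I] by simp
    ultimately show ?thesis
      unfolding is_path_graph_def induced_def fst_conv snd_conv by blast
  qed
  have comps_path: "graph_components (p ` ?Q, EP) = induced (p ` ?Q, EP) ` (blk ` F)"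
  proof (rule graph_components_eqI)
    show "\<Union> (blk ` F) = p ` ?Q" by (auto simp: blk_def Q_def)
    show "C = D" if "C \<in> blk ` F" "D \<in> blk ` F" "C \<inter> D \<noteq> {}" for C D
    proof -
      obtain I K where "I \<in> F" "K \<in> F" "C = blk I" "D = blk K" using \<open>C \<in> _\<close> \<open>D \<in> _\<close> by blast
      then show ?thesis using blk_disj[of I K] \<open>C \<inter> D \<noteq> {}\<close> by simp
    qed
    show "\<exists>C\<in>blk ` F. e \<subseteq> C" if "e \<in> EP" for e
      using blk_edge[OF that] by simp
    show "\<exists>c\<in>C. \<forall>v\<in>C. (c, v) \<in> reachable_in (p ` ?Q, EP)" if "C \<in> blk ` F" for C
      using that blk_conn by (elim imageE) simp
  qed
  have comps_W_path: "graph_components (W, EP) = induced (W, EP) ` (blk ` F \<union> (\<lambda>a. {s a}) ` T)"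
  proof (rule graph_components_eqI)
    show "\<Union> (blk ` F \<union> (\<lambda>a. {s a}) ` T) = W" by (auto simp: blk_def Q_def W_def)
    show "C = D" if CD: "C \<in> blk ` F \<union> (\<lambda>a. {s a}) ` T" "D \<in> blk ` F \<union> (\<lambda>a. {s a}) ` T" "C \<inter> D \<noteq> {}" for C D
    proof -
      have apart: "s a \<notin> blk I" if "a \<in> T" "I \<in> F" for a I
        using blk_sub that inj(3) by blast
      show ?thesis
      proof (cases "C \<in> blk ` F")
        case True
        then obtain I where I: "I \<in> F" "C = blk I" by blast
        have "D \<in> blk ` F" using apart[OF _ I(1)] CD(2,3) I(2) by auto
        then obtain K where "K \<in> F" "D = blk K" by blast
        then show ?thesis using blk_disj[of I K] I CD(3) by simp
      next
        case False
        then obtain a where a: "a \<in> T" "C = {s a}" using CD(1) by blast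
        then have "D \<notin> blk ` F" using apart CD(3) by auto
        then show ?thesis using CD(2,3) a by auto
      qed
    qed
    show "\<exists>c\<in>C. \<forall>v\<in>C. (c, v) \<in> reachable_in (W, EP)" if "C \<in> blk ` F \<union> (\<lambda>a. {s a}) ` T" for C
    proof (cases "C \<in> blk ` F")
      case True
      then show ?thesis using blk_conn by (elim imageE) simp
    next
      case False
      then show ?thesis using that by (auto simp: reachable_in_refl)
    qed
    show "\<exists>C\<in>blk ` F \<union> (\<lambda>a. {s a}) ` T. e \<subseteq> C" if "e \<in> EP" for e
      using blk_edge[OF that] by blast
  qed
  \<comment> \<open>Every star vertex with its leaves is a component of the star edges; positions with other letters are trivial stars.\<close>
  define st where "st a = insert (s a) (p ` {i \<in> ?Q. \<alpha> i = a})" for a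
  let ?stars = "st ` T \<union> (\<lambda>i. {p i}) ` {i \<in> ?Q. \<alpha> i \<notin> T}"
  have comps_W_star: "graph_components (W, ES) = induced (W, ES) ` ?stars"
  proof (rule graph_components_eqI)
    show "\<Union> ?stars = W" by (auto simp: st_def W_def)
    show "C = D" if "C \<in> ?stars" "D \<in> ?stars" "C \<inter> D \<noteq> {}" for C D
    proof -
      have st_st: "a = c" if "a \<in> T" "c \<in> T" "st a \<inter> st c \<noteq> {}" for a c
        using that by (auto simp: st_def p_eq s_eq p_ne_s)
      have st_p: "\<alpha> i = a" if "a \<in> T" "i \<in> ?Q" "p i \<in> st a" for a i
        using that by (auto simp: st_def p_eq p_ne_s)
      show ?thesis
      proof (cases "C \<in> st ` T")
        case True
        then have "D \<in> st ` T" using st_p that by auto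
        then show ?thesis using True st_st that(3) by auto
      next
        case False
        then have "D \<notin> st ` T" using st_p that by auto
        then show ?thesis using False that by auto
      qed
    qed
    show "\<exists>C\<in>?stars. e \<subseteq> C" if "e \<in> ES" for e
      using that by (auto simp: ES_def st_def)
    show "\<exists>c\<in>C. \<forall>v\<in>C. (c, v) \<in> reachable_in (W, ES)" if "C \<in> ?stars" for C
    proof -
      have "(s a, p i) \<in> reachable_in (W, ES)" if "a \<in> T" "i \<in> ?Q" "\<alpha> i = a" for a i
      proof (rule reachable_in_step[OF reachable_in_refl])
        show "{s a, p i} \<in> edges_of (W, ES)" using that by (auto simp: ES_def insert_commute)
      qed
      then show ?thesis using that by (auto simp: st_def reachable_in_refl)
    qed
  qed
  have stars: "is_star_graph (induced (W, ES) C)" if C: "C \<in> ?stars" for C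
  proof -
    consider a where "a \<in> T" "C = st a" | i where "i \<in> ?Q" "\<alpha> i \<notin> T" "C = {p i}" using C by blast
    then show ?thesis
    proof cases
      case 1
      have "{e \<in> ES. e \<subseteq> st a} = {{s a, v} | v. v \<in> st a - {s a}}"
      proof (intro equalityI subsetI)
        fix e assume "e \<in> {e \<in> ES. e \<subseteq> st a}"
        then obtain i where i: "e = {p i, s (\<alpha> i)}" "i \<in> ?Q" "\<alpha> i \<in> T" "s (\<alpha> i) \<in> st a"
          by (auto simp: ES_def)
        then have "\<alpha> i = a" using 1 p_ne_s s_eq by (auto simp: st_def)
        then show "e \<in> {{s a, v} | v. v \<in> st a - {s a}}"
          using i 1 p_ne_s by (auto simp: st_def insert_commute)
      next
        fix e assume "e \<in> {{s a, v} | v. v \<in> st a - {s a}}"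
        then obtain i where "e = {s a, p i}" "i \<in> ?Q" "\<alpha> i = a" by (auto simp: st_def)
        then show "e \<in> {e \<in> ES. e \<subseteq> st a}" using 1 by (auto simp: ES_def st_def insert_commute)
      qed
      then show ?thesis using 1 unfolding is_star_graph_def induced_def
        by (intro bexI[of _ "s a"]) (auto simp: st_def)
    next
      case 2
      have "{e \<in> ES. e \<subseteq> {p i}} = {}" using 2 p_ne_s by (fastforce simp: ES_def)
      then show ?thesis using 2 unfolding is_star_graph_def induced_def by auto
    qed
  qed
  have EP_avoids: "e \<inter> s ` T = {}" if e: "e \<in> EP" for e
  proof -
    obtain i where "e = {p i, p (Suc i)}" "i \<in> ?Q" "Suc i \<in> ?Q"
      using e unfolding EP_def by blast
    then show ?thesis using inj(3) by auto
  qed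
  have ES_meets: "e \<inter> s ` T \<noteq> {}" if "e \<in> ES" for e
    using that unfolding ES_def by auto
  have "simple_graph (induced G W)" using G by (simp add: simple_graph_def induced_def)
  moreover have "finite W" using finQ T(1) by (simp add: W_def)
  ultimately have fin_W: "finite_graph (W, EP \<union> ES)"
    unfolding finite_graph_def induced_W by simp
  have disj_E: "EP \<inter> ES = {}"
  proof (rule equals0I)
    fix e assume "e \<in> EP \<inter> ES"
    then show False using EP_avoids[of e] ES_meets[of e] by simp
  qed
  have single: "is_path_graph (induced (W, EP) {s a})" if "a \<in> T" for a
  proof -
    have none: "\<not> e \<subseteq> {s a}" if "e \<in> EP" for e
    proof
      assume "e \<subseteq> {s a}"
      then have "e = {} \<or> e = {s a}" by (rule subset_singletonD)
      moreover have "e \<noteq> {}" using that unfolding EP_def by force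
      ultimately show False using EP_avoids[OF that] \<open>a \<in> T\<close> by simp
    qed
    then have "{e \<in> EP. e \<subseteq> {s a}} = {}" by blast
    then show ?thesis unfolding is_path_graph_def induced_def
      by (intro exI[of _ "[s a]"]) simp
  qed
  have paths_W: "is_path_graph C" if C: "C \<in> graph_components (W, EP)" for C
  proof -
    have "C \<in> induced (W, EP) ` (blk ` F) \<or> C \<in> induced (W, EP) ` ((\<lambda>a. {s a}) ` T)"
      using C unfolding comps_W_path image_Un by (rule UnE) simp_all
    then show ?thesis using blk_path single by (elim disjE imageE) simp_all
  qed
  have stars_W: "is_star_graph C" if "C \<in> graph_components (W, ES)" for C
    using that stars unfolding comps_W_star by (elim imageE) simp
  have part: "path_star_partition (induced G W) EP ES"
    unfolding path_star_partition_def induced_W fst_conv snd_conv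
    using fin_W disj_E paths_W stars_W by simp
  obtain g where g: "bij_betw g {1..t} T"
    using ex_bij_betw_nat_finite_1[OF T(1)] T(2) by auto
  obtain h where h: "bij_betw h {1..t} F"
    using ex_bij_betw_nat_finite_1[OF F(1)] F(2) by auto
  let ?P = "\<lambda>I. induced (p ` ?Q, EP) (blk I)"
  have hF: "h i \<in> F" if "i \<in> {1..t}" for i by (rule bij_betw_apply[OF h that])
  have VW: "W - s ` T = p ` ?Q"
    unfolding W_def using inj(3) by (simp add: Un_Diff Diff_triv)
  have "inj_on ?P F"
  proof (rule inj_onI)
    fix I K assume IK: "I \<in> F" "K \<in> F" "?P I = ?P K"
    then have "blk I = blk K" by (simp add: induced_def)
    moreover have "blk I \<noteq> {}" using le[OF IK(1)] by (simp add: blk_def)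
    ultimately show "I = K" using blk_disj[OF IK(1,2)] by simp
  qed
  then have "bij_betw ?P F (graph_components (p ` ?Q, EP))"
    unfolding comps_path by (simp add: bij_betw_def image_image)
  then have P_bij: "bij_betw (?P \<circ> h) {1..t} (graph_components (p ` ?Q, EP))"
    by (rule bij_betw_trans[OF h])
  have touch: "\<exists>v\<in>verts_of ((?P \<circ> h) i). {(s \<circ> g) j, v} \<in> ES" if i: "i \<in> {1..t}" and j: "j \<in> {1..t}" for i j
  proof -
    have gj: "g j \<in> T" by (rule bij_betw_apply[OF g j])
    obtain x where x: "x \<in> {fst (h i)..snd (h i)}" "\<alpha> x = g j"
      using subsetD[OF T(3)[OF hF[OF i]] gj] by (elim imageE) simp
    have xQ: "x \<in> ?Q" using in_Q[OF hF[OF i]] x(1) by simp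
    have "{p x, s (\<alpha> x)} \<in> ES"
      unfolding ES_def using x(2) gj xQ by (intro CollectI exI[of _ x] conjI) simp_all
    then have "{s (g j), p x} \<in> ES" by (simp add: x(2) insert_commute)
    moreover have "p x \<in> verts_of ((?P \<circ> h) i)" using x(1) by (simp add: induced_def blk_def)
    ultimately show ?thesis unfolding comp_def by (rule bexI)
  qed
  have "is_sail t (W, EP \<union> ES)"
  proof (rule is_sailI[of _ EP ES "s ` T" "s \<circ> g" _ "?P \<circ> h"])
    show "path_star_partition (W, EP \<union> ES) EP ES" using part unfolding induced_W .
    show "s ` T \<subseteq> verts_of (W, EP \<union> ES)" by (simp add: W_def)
    show "bij_betw (s \<circ> g) {1..t} (s ` T)"
      by (rule bij_betw_trans[OF g inj_on_imp_bij_betw[OF inj(2)]])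
    show "e \<inter> s ` T = {}" if "e \<in> EP" for e using that by (rule EP_avoids)
    show "bij_betw (?P \<circ> h) {1..t} (graph_components (verts_of (W, EP \<union> ES) - s ` T, EP))"
      unfolding fst_conv VW by (rule P_bij)
    show "is_path_graph ((?P \<circ> h) i)" if "i \<in> {1..t}" for i
      using blk_path[OF hF[OF that]] by simp
    show "\<exists>v\<in>verts_of ((?P \<circ> h) i). {(s \<circ> g) j, v} \<in> ES" if "i \<in> {1..t}" "j \<in> {1..t}" for i j
      using that by (rule touch)
  qed
  then have "is_sail t (induced G W)" unfolding induced_W .
  moreover have "W \<subseteq> verts_of G" using sub by (simp add: W_def)
  ultimately show ?thesis
    unfolding has_induced_sail_def by blast
qed

section \<open>Many disjoint full intervals or few positions hitting all of them\<close>

text \<open>The greedy argument for packing and covering of intervals. Take the full interval with the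
smallest right end \<open>y\<close>, delete \<open>y\<close> and its successor, and continue to the right: everything
left of \<open>y\<close> is not full by minimality, and everything right of \<open>Suc y\<close> is separated from the
chosen interval. Each round deletes at most two positions.\<close>

lemma separated_intervals_or_hitting_set:
  fixes full :: "nat \<Rightarrow> nat \<Rightarrow> bool"
  assumes "finite J"
  shows "(\<exists>F. finite F \<and> card F = n \<and> separated_intervals F \<and>
            (\<forall>I\<in>F. {fst I..snd I} \<subseteq> J \<and> full (fst I) (snd I))) \<or>
         (\<exists>D\<subseteq>J. card D \<le> 2 * n \<and> (\<forall>x y. x \<le> y \<longrightarrow> {x..y} \<subseteq> J - D \<longrightarrow> \<not> full x y))"
  using assms
proof (induction n arbitrary: J)
  case 0
  then show ?case by (auto simp: separated_intervals_def)
next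
  case (Suc n)
  show ?case
  proof (cases "\<exists>y. \<exists>x\<le>y. {x..y} \<subseteq> J \<and> full x y")
    case False
    then have "\<forall>x y. x \<le> y \<longrightarrow> {x..y} \<subseteq> J - {} \<longrightarrow> \<not> full x y" by auto
    then show ?thesis by (intro disjI2 exI[of _ "{}"]) simp
  next
    case True
    define y where "y = (LEAST y. \<exists>x\<le>y. {x..y} \<subseteq> J \<and> full x y)"
    obtain x where x: "x \<le> y" "{x..y} \<subseteq> J" "full x y"
      using LeastI_ex[OF True] unfolding y_def by blast
    have first: "\<not> full a c" if "a \<le> c" "{a..c} \<subseteq> J" "c < y" for a c
      using not_less_Least[of c] that unfolding y_def by blast
    define J2 where "J2 = {j \<in> J. Suc y < j}"
    have "finite J2" using Suc.prems by (simp add: J2_def)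
    from Suc.IH[OF this] show ?thesis
    proof
      assume "\<exists>F. finite F \<and> card F = n \<and> separated_intervals F \<and>
            (\<forall>I\<in>F. {fst I..snd I} \<subseteq> J2 \<and> full (fst I) (snd I))"
      then obtain F where F: "finite F" "card F = n" "separated_intervals F"
        "\<And>I. I \<in> F \<Longrightarrow> {fst I..snd I} \<subseteq> J2" "\<And>I. I \<in> F \<Longrightarrow> full (fst I) (snd I)" by blast
      have right: "Suc y < fst I" if "I \<in> F" for I
      proof -
        have "fst I \<in> {fst I..snd I}" using F(3) that by (simp add: separated_intervals_def)
        then show ?thesis using F(4)[OF that] unfolding J2_def by blast
      qed
      have "(x, y) \<notin> F" using right x(1) by force
      moreover have "separated_intervals (insert (x, y) F)"
        using F(3) right x(1) unfolding separated_intervals_def by auto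
      moreover have "\<forall>I\<in>F. {fst I..snd I} \<subseteq> J" using F(4) unfolding J2_def by blast
      ultimately show ?thesis
        using F x by (intro disjI1 exI[of _ "insert (x, y) F"]) auto
    next
      assume "\<exists>D\<subseteq>J2. card D \<le> 2 * n \<and> (\<forall>x y. x \<le> y \<longrightarrow> {x..y} \<subseteq> J2 - D \<longrightarrow> \<not> full x y)"
      then obtain D where D: "D \<subseteq> J2" "card D \<le> 2 * n"
        "\<And>x y. x \<le> y \<Longrightarrow> {x..y} \<subseteq> J2 - D \<Longrightarrow> \<not> full x y" by blast
      let ?D = "D \<union> ({y, Suc y} \<inter> J)"
      have "card ({y, Suc y} \<inter> J) \<le> card {y, Suc y}" by (intro card_mono) auto
      then have "card ?D \<le> 2 * Suc n" using card_Un_le[of D "{y, Suc y} \<inter> J"] D(2) by auto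
      moreover have "\<not> full a c" if ac: "a \<le> c" "{a..c} \<subseteq> J - ?D" for a c
      proof (cases "c < y")
        case True
        then show ?thesis using first ac by blast
      next
        case False
        have "y \<notin> {a..c}" "Suc y \<notin> {a..c}" using ac by blast+
        then have "Suc y < a" using False ac(1) by auto
        then have "{a..c} \<subseteq> J2 - D" using ac unfolding J2_def by auto
        then show ?thesis using D(3) ac(1) by blast
      qed
      moreover have "?D \<subseteq> J" using D(1) by (auto simp: J2_def)
      ultimately show ?thesis by blast
    qed
  qed
qed

text \<open>Each interval of \<open>F\<close> selects one letter from each of the \<open>t\<close> sets \<open>B k\<close>; there are at most
\<open>b ^ t\<close> selections, so some \<open>t\<close> intervals agree on theirs. The selected letters are distinct
because the sets are disjoint.\<close>

lemma common_transversal: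
  fixes \<alpha> :: "nat \<Rightarrow> nat" and B :: "nat \<Rightarrow> nat set"
  assumes B: "\<And>k. k < t \<Longrightarrow> finite (B k) \<and> card (B k) \<le> b"
    and disj: "\<And>k l. k < t \<Longrightarrow> l < t \<Longrightarrow> k \<noteq> l \<Longrightarrow> B k \<inter> B l = {}"
    and F: "finite F" "t * b ^ t < card F"
    and full: "\<And>I k. I \<in> F \<Longrightarrow> k < t \<Longrightarrow> \<exists>j\<in>{fst I..snd I}. \<alpha> j \<in> B k"
  obtains F' T where "F' \<subseteq> F" "card F' = t" "T \<subseteq> (\<Union>k<t. B k)" "finite T" "card T = t"
    "\<And>I. I \<in> F' \<Longrightarrow> T \<subseteq> \<alpha> ` {fst I..snd I}"
proof -
  have "\<forall>I\<in>F. \<exists>f\<in>PiE {..<t} B. \<forall>k<t. f k \<in> \<alpha> ` {fst I..snd I}"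
  proof
    fix I assume "I \<in> F"
    then have "\<forall>k<t. \<exists>a\<in>B k. a \<in> \<alpha> ` {fst I..snd I}" using full by blast
    then obtain c where "\<forall>k<t. c k \<in> B k \<and> c k \<in> \<alpha> ` {fst I..snd I}" by metis
    then show "\<exists>f\<in>PiE {..<t} B. \<forall>k<t. f k \<in> \<alpha> ` {fst I..snd I}"
      by (intro bexI[of _ "restrict c {..<t}"]) auto
  qed
  then obtain g where g: "\<And>I. I \<in> F \<Longrightarrow> g I \<in> PiE {..<t} B"
    "\<And>I k. I \<in> F \<Longrightarrow> k < t \<Longrightarrow> g I k \<in> \<alpha> ` {fst I..snd I}" by metis
  let ?P = "PiE {..<t} B"
  have finP: "finite ?P" using B by (intro finite_PiE) auto
  have "card ?P = (\<Prod>k<t. card (B k))" by (simp add: card_PiE)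
  also have "\<dots> \<le> (\<Prod>k<t. b)" using B by (intro prod_mono) auto
  finally have cardP: "card ?P \<le> b ^ t" by simp
  have "\<exists>f\<in>?P. t \<le> card {I \<in> F. g I = f}"
  proof (rule ccontr)
    assume "\<not> ?thesis"
    then have small: "card {I \<in> F. g I = f} \<le> t" if "f \<in> ?P" for f using that by force
    have "F = (\<Union>f\<in>?P. {I \<in> F. g I = f})" using g(1) by blast
    then have "card F \<le> (\<Sum>f\<in>?P. card {I \<in> F. g I = f})" using card_UN_le[OF finP] by metis
    also have "\<dots> \<le> card ?P * t" using small sum_bounded_above[of ?P _ t] by auto
    also have "\<dots> \<le> t * b ^ t" using cardP by simp
    finally show False using F(2) by simp
  qed
  then obtain f where f: "f \<in> ?P" "t \<le> card {I \<in> F. g I = f}" by blast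
  obtain F' where F': "F' \<subseteq> {I \<in> F. g I = f}" "card F' = t"
    using obtain_subset_with_card_n[OF f(2)] by blast
  have "inj_on f {..<t}"
  proof (rule inj_onI)
    fix k l assume kl: "k \<in> {..<t}" "l \<in> {..<t}" "f k = f l"
    then have "f k \<in> B k \<inter> B l" using f(1) by (auto simp: PiE_def Pi_def)
    then show "k = l" using disj kl by blast
  qed
  then have "card (f ` {..<t}) = t" by (simp add: card_image)
  moreover have "f ` {..<t} \<subseteq> (\<Union>k<t. B k)" using f(1) by auto
  moreover have "f ` {..<t} \<subseteq> \<alpha> ` {fst I..snd I}" if "I \<in> F'" for I
  proof -
    have "I \<in> F" "g I = f" using that F'(1) by auto
    then show ?thesis using g(2)[of I] by auto
  qed
  ultimately show ?thesis using that[of F' "f ` {..<t}"] F' by blast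
qed

section \<open>Sweeping a graph whose path components are runs\<close>

text \<open>The situation after the deletions. Within a component of \<open>J\<close>, the letters of \<open>S\<close> that are
read one after the other have consecutive ranks, so the component covers an interval of ranks.
The last assumption holds in a graph without a sail: fewer than \<open>t\<close> separated intervals
cover the same \<open>t\<close> consecutive ranks.\<close>

locale ranked_runs =
  fixes \<alpha> :: "nat \<Rightarrow> nat" and J S :: "nat set" and rank :: "nat \<Rightarrow> nat" and t :: nat
  assumes finite_J: "finite J" and finite_S: "finite S" and rank_inj: "inj_on rank S"
    and t_pos: "1 \<le> t"
    and run: "\<And>x y. x < y \<Longrightarrow> {x..y} \<subseteq> J \<Longrightarrow> \<alpha> x \<in> S \<Longrightarrow> \<alpha> y \<in> S \<Longrightarrow>
      (\<And>z. x < z \<Longrightarrow> z < y \<Longrightarrow> \<alpha> z \<notin> S) \<Longrightarrow> rank (\<alpha> y) = Suc (rank (\<alpha> x))"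
    and few_cover_window: "\<And>F w. finite F \<Longrightarrow> card F = t \<Longrightarrow> separated_intervals F \<Longrightarrow>
      (\<And>I. I \<in> F \<Longrightarrow> {fst I..snd I} \<subseteq> J) \<Longrightarrow>
      (\<And>I. I \<in> F \<Longrightarrow> {w..<w + t} \<subseteq> rank ` (\<alpha> ` {fst I..snd I} \<inter> S)) \<Longrightarrow> False"
begin

text \<open>A discrete intermediate value property: ranks grow by steps of one along a piece of the path.\<close>

lemma rank_along_run:
  assumes "x < y" "{x..y} \<subseteq> J" "\<alpha> x \<in> S" "\<alpha> y \<in> S"
  shows "rank (\<alpha> x) < rank (\<alpha> y) \<and> {rank (\<alpha> x)..rank (\<alpha> y)} \<subseteq> rank ` (\<alpha> ` {x..y} \<inter> S)"
  using assms
proof (induction "y - x" arbitrary: x y rule: less_induct)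
  case less
  show ?case
  proof (cases "\<exists>z. x < z \<and> z < y \<and> \<alpha> z \<in> S")
    case False
    then have "rank (\<alpha> y) = Suc (rank (\<alpha> x))" using run less.prems by blast
    moreover from this have "{rank (\<alpha> x)..rank (\<alpha> y)} = {rank (\<alpha> x), rank (\<alpha> y)}" by auto
    moreover have "rank (\<alpha> x) \<in> rank ` (\<alpha> ` {x..y} \<inter> S)" "rank (\<alpha> y) \<in> rank ` (\<alpha> ` {x..y} \<inter> S)"
      using less.prems by (auto intro!: imageI)
    ultimately show ?thesis by simp
  next
    case True
    then obtain z where z: "x < z" "z < y" "\<alpha> z \<in> S" by blast
    have sub: "{x..z} \<subseteq> J" "{z..y} \<subseteq> J" using less.prems(2) z by auto
    have left: "rank (\<alpha> x) < rank (\<alpha> z) \<and> {rank (\<alpha> x)..rank (\<alpha> z)} \<subseteq> rank ` (\<alpha> ` {x..z} \<inter> S)"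
      using less.hyps[of z x] z sub less.prems by auto
    have right: "rank (\<alpha> z) < rank (\<alpha> y) \<and> {rank (\<alpha> z)..rank (\<alpha> y)} \<subseteq> rank ` (\<alpha> ` {z..y} \<inter> S)"
      using less.hyps[of y z] z sub less.prems by auto
    have "{rank (\<alpha> x)..rank (\<alpha> y)} \<subseteq> {rank (\<alpha> x)..rank (\<alpha> z)} \<union> {rank (\<alpha> z)..rank (\<alpha> y)}"
      by auto
    also have "\<dots> \<subseteq> rank ` (\<alpha> ` {x..z} \<inter> S) \<union> rank ` (\<alpha> ` {z..y} \<inter> S)"
      using left right by blast
    also have "\<dots> \<subseteq> rank ` (\<alpha> ` {x..y} \<inter> S)"
    proof -
      have "{x..z} \<subseteq> {x..y}" "{z..y} \<subseteq> {x..y}" using z by auto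
      then show ?thesis by blast
    qed
    finally show ?thesis using left right by simp
  qed
qed

definition same_piece :: "nat \<Rightarrow> nat \<Rightarrow> bool" where
  "same_piece x y \<longleftrightarrow> {min x y..max x y} \<subseteq> J"

lemma same_piece_sym: "same_piece x y \<Longrightarrow> same_piece y x"
  by (simp add: same_piece_def min.commute max.commute)

lemma same_piece_trans: 
  assumes "same_piece x y" "same_piece y z"
  shows "same_piece x z"
proof -
  have "{min x z..max x z} \<subseteq> {min x y..max x y} \<union> {min y z..max y z}" by auto
  then show ?thesis using assms unfolding same_piece_def by blast
qed

lemma same_piece_mem: "same_piece x y \<Longrightarrow> x \<in> J" "same_piece x y \<Longrightarrow> y \<in> J"
  unfolding same_piece_def by auto

lemma same_piece_Suc: "p \<in> J \<Longrightarrow> Suc p \<in> J \<Longrightarrow> same_piece p (Suc p)"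
  by (auto simp: same_piece_def le_Suc_eq)

definition piece_letters :: "nat \<Rightarrow> nat set" where
  "piece_letters p = {q. same_piece p q \<and> \<alpha> q \<in> S}"

text \<open>A piece without letters of \<open>S\<close> gets the top rank 0.\<close>

definition top_rank :: "nat \<Rightarrow> nat" where
  "top_rank p = Max (insert 0 ((\<lambda>q. rank (\<alpha> q)) ` piece_letters p))"

text \<open>The time at which the sweep visits position \<open>p\<close>. The star with rank \<open>r\<close> is visited at time
\<open>r\<close>, and a position whose next letter has rank \<open>r\<close> only \<open>t - 1\<close> ranks later, or when
the last star of its piece has been visited. Because of the delay, a piece that the sweep enters
before time \<open>\<tau>\<close> and does not finish before \<open>\<tau>\<close> covers the \<open>t\<close> ranks below \<open>\<tau>\<close>, so
there are fewer than \<open>t\<close> such pieces; and since the delay is bounded, a star waits for its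
neighbours for less than \<open>t\<close> steps.\<close>

definition time :: "nat \<Rightarrow> nat" where
  "time p = Min (insert (top_rank p) ((\<lambda>q. rank (\<alpha> q) + t - 1) ` {q \<in> piece_letters p. p \<le> q}))"

lemma finite_piece_letters: "finite (piece_letters p)"
  by (rule finite_subset[OF _ finite_J]) (auto simp: piece_letters_def dest: same_piece_mem)

lemma piece_letters_cong: "same_piece p q \<Longrightarrow> piece_letters p = piece_letters q"
  unfolding piece_letters_def using same_piece_sym same_piece_trans by blast

lemma top_rank_cong: "same_piece p q \<Longrightarrow> top_rank p = top_rank q"
  by (simp add: top_rank_def piece_letters_cong)

lemma time_le_top_rank: "time p \<le> top_rank p"
  unfolding time_def using finite_piece_letters by simp

lemma rank_le_top_rank: "q \<in> piece_letters p \<Longrightarrow> rank (\<alpha> q) \<le> top_rank p"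
  unfolding top_rank_def using finite_piece_letters by (intro Max_ge) auto

lemma time_mono:
  assumes "same_piece p q" "p \<le> q"
  shows "time p \<le> time q"
  unfolding time_def
proof (rule Min_antimono)
  show "insert (top_rank q) ((\<lambda>x. rank (\<alpha> x) + t - 1) ` {x \<in> piece_letters q. q \<le> x})
    \<subseteq> insert (top_rank p) ((\<lambda>x. rank (\<alpha> x) + t - 1) ` {x \<in> piece_letters p. p \<le> x})"
    using assms top_rank_cong[OF assms(1)] piece_letters_cong[OF assms(1)] by force
qed (use finite_piece_letters in auto)

lemma rank_mono_in_piece:
  assumes "p \<in> piece_letters x" "q \<in> piece_letters x" "p < q"
  shows "rank (\<alpha> p) < rank (\<alpha> q) \<and> {p..q} \<subseteq> J \<and>
    {rank (\<alpha> p)..rank (\<alpha> q)} \<subseteq> rank ` (\<alpha> ` {p..q} \<inter> S)"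
proof -
  have "same_piece p q"
    using assms same_piece_sym same_piece_trans unfolding piece_letters_def by blast
  then have "{p..q} \<subseteq> J" using assms(3) by (simp add: same_piece_def)
  then show ?thesis using rank_along_run assms unfolding piece_letters_def by simp
qed

lemma time_of_letter:
  assumes "p \<in> J" "\<alpha> p \<in> S"
  shows "rank (\<alpha> p) \<le> time p" "time p \<le> rank (\<alpha> p) + t - 1"
proof -
  have p: "p \<in> piece_letters p" using assms by (simp add: piece_letters_def same_piece_def)
  have "rank (\<alpha> p) \<le> rank (\<alpha> q) + t - 1" if "q \<in> piece_letters p" "p \<le> q" for q
    using rank_mono_in_piece[OF p that(1)] that(2) t_pos by (cases "p = q") auto
  then show "rank (\<alpha> p) \<le> time p"
    unfolding time_def using finite_piece_letters rank_le_top_rank[OF p] by (intro Min.boundedI) auto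
  show "time p \<le> rank (\<alpha> p) + t - 1"
    unfolding time_def using finite_piece_letters p by (intro Min_le) auto
qed

text \<open>The time of \<open>p\<close> is below the top rank of its piece, so it comes from some letter \<open>l\<close> of rank
\<open>time p - t + 1\<close>; together with the letter of top rank this spans the window of \<open>t\<close> ranks below
\<open>\<tau>\<close>.\<close>

lemma crossing_covers_window:
  assumes "p \<in> J" "Suc p \<in> J" "time p < \<tau>" "\<tau> \<le> time (Suc p)"
  obtains l r where "l \<le> r" "{l..r} \<subseteq> J" "same_piece p l"
    "{\<tau> - t..<\<tau> - t + t} \<subseteq> rank ` (\<alpha> ` {l..r} \<inter> S)"
proof -
  have top: "\<tau> \<le> top_rank p"
    using assms(4) time_le_top_rank[of "Suc p"] top_rank_cong[OF same_piece_Suc] assms(1,2) by simp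
  have "time p \<in> insert (top_rank p) ((\<lambda>q. rank (\<alpha> q) + t - 1) ` {q \<in> piece_letters p. p \<le> q})"
    unfolding time_def using finite_piece_letters by (intro Min_in) auto
  then obtain l where l: "l \<in> piece_letters p" "time p = rank (\<alpha> l) + t - 1"
    using top assms(3) by auto
  have "top_rank p \<in> insert 0 ((\<lambda>q. rank (\<alpha> q)) ` piece_letters p)"
    unfolding top_rank_def using finite_piece_letters by (intro Max_in) auto
  then obtain r where r: "r \<in> piece_letters p" "top_rank p = rank (\<alpha> r)"
    using top assms(3) by auto
  have rank_lr: "rank (\<alpha> l) + t \<le> \<tau>" "\<tau> \<le> rank (\<alpha> r)" using l r top assms(3) t_pos by auto
  then have "rank (\<alpha> l) < rank (\<alpha> r)" using t_pos by simp
  then have "l < r" using rank_mono_in_piece[OF r(1) l(1)] by (cases l r rule: linorder_cases) auto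
  note lr = rank_mono_in_piece[OF l(1) r(1) \<open>l < r\<close>]
  have "{\<tau> - t..<\<tau> - t + t} \<subseteq> {rank (\<alpha> l)..rank (\<alpha> r)}" using rank_lr by auto
  then show ?thesis
    using that[of l r] lr l(1) \<open>l < r\<close> unfolding piece_letters_def by auto
qed

definition crossing :: "nat \<Rightarrow> nat set" where
  "crossing \<tau> = {p. p \<in> J \<and> Suc p \<in> J \<and> time p < \<tau> \<and> \<tau> \<le> time (Suc p)}"

lemma finite_crossing: "finite (crossing \<tau>)"
  by (rule finite_subset[OF _ finite_J]) (auto simp: crossing_def)

text \<open>Times grow along a piece, so a piece crosses a given moment at most once.\<close>

lemma crossing_distinct_pieces:
  assumes "p \<in> crossing \<tau>" "q \<in> crossing \<tau>" "same_piece p q"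
  shows "p = q"
proof -
  have False if "p < q" "same_piece p q" "p \<in> crossing \<tau>" "q \<in> crossing \<tau>" for p q
  proof -
    have "same_piece (Suc p) q" using that unfolding same_piece_def by auto
    then have "time (Suc p) \<le> time q" using time_mono that(1) by simp
    then show False using that(3,4) by (simp add: crossing_def)
  qed
  then show ?thesis using assms same_piece_sym by (cases p q rule: linorder_cases) blast+
qed

lemma card_crossing: "card (crossing \<tau>) < t"
proof (rule ccontr)
  assume "\<not> card (crossing \<tau>) < t"
  then obtain P where P: "P \<subseteq> crossing \<tau>" "card P = t" "finite P"
    using obtain_subset_with_card_n[of t "crossing \<tau>"] finite_crossing finite_subset by (metis not_less)
  have "\<forall>p\<in>P. \<exists>I. fst I \<le> snd I \<and> {fst I..snd I} \<subseteq> J \<and> same_piece p (fst I) \<and>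
    {\<tau> - t..<\<tau> - t + t} \<subseteq> rank ` (\<alpha> ` {fst I..snd I} \<inter> S)"
  proof
    fix p assume "p \<in> P"
    then have p: "p \<in> J" "Suc p \<in> J" "time p < \<tau>" "\<tau> \<le> time (Suc p)"
      using P(1) by (auto simp: crossing_def)
    obtain l r where "l \<le> r" "{l..r} \<subseteq> J" "same_piece p l"
      "{\<tau> - t..<\<tau> - t + t} \<subseteq> rank ` (\<alpha> ` {l..r} \<inter> S)"
      using crossing_covers_window[OF p] .
    then show "\<exists>I. fst I \<le> snd I \<and> {fst I..snd I} \<subseteq> J \<and> same_piece p (fst I) \<and>
      {\<tau> - t..<\<tau> - t + t} \<subseteq> rank ` (\<alpha> ` {fst I..snd I} \<inter> S)"
      by (intro exI[of _ "(l, r)"]) simp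
  qed
  then obtain I where I: "\<And>p. p \<in> P \<Longrightarrow> fst (I p) \<le> snd (I p)"
    "\<And>p. p \<in> P \<Longrightarrow> {fst (I p)..snd (I p)} \<subseteq> J"
    "\<And>p. p \<in> P \<Longrightarrow> same_piece p (fst (I p))"
    "\<And>p. p \<in> P \<Longrightarrow> {\<tau> - t..<\<tau> - t + t} \<subseteq> rank ` (\<alpha> ` {fst (I p)..snd (I p)} \<inter> S)"
    by metis
  have eq: "p = q" if pq: "p \<in> P" "q \<in> P" "same_piece (fst (I p)) (fst (I q))" for p q
    using pq P(1) I(3) same_piece_trans same_piece_sym crossing_distinct_pieces
    by (meson subsetD)
  have near: "p = q" if pq: "p \<in> P" "q \<in> P" "fst (I q) \<le> snd (I p) + 1" "fst (I p) \<le> snd (I q) + 1" for p q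
  proof -
    have "{min (fst (I p)) (fst (I q))..max (fst (I p)) (fst (I q))}
      \<subseteq> {fst (I p)..snd (I p)} \<union> {fst (I q)..snd (I q)}"
      using pq I(1)[OF pq(1)] I(1)[OF pq(2)] by auto
    then have "same_piece (fst (I p)) (fst (I q))"
      using I(2)[OF pq(1)] I(2)[OF pq(2)] unfolding same_piece_def by blast
    then show ?thesis using eq pq by blast
  qed
  have "inj_on I P"
    using near I(1) by (intro inj_onI) (metis le_add1 order_trans)
  then have "card (I ` P) = t" using P by (simp add: card_image)
  moreover have "separated_intervals (I ` P)"
    unfolding separated_intervals_def using near I(1) by (auto simp: not_less) (metis not_less)
  moreover have "finite (I ` P)" using P(3) by simp
  moreover have "{fst K..snd K} \<subseteq> J" if "K \<in> I ` P" for K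
    using that I(2) by blast
  moreover have "{\<tau> - t..<\<tau> - t + t} \<subseteq> rank ` (\<alpha> ` {fst K..snd K} \<inter> S)" if "K \<in> I ` P" for K
    using that I(4) by blast
  ultimately show False using few_cover_window by metis
qed

text \<open>A bag contains at most \<open>t\<close> stars, the path vertices from which a piece crosses the current
or the next moment (fewer than \<open>t\<close> each), and at most two path vertices at which the sweep
stands within the current time.\<close>

lemma sweep_key_exists:
  "\<exists>key. \<forall>i. card (sweep_bag (R_graph \<alpha>) (Path_Vertex ` J \<union> Star_Vertex ` S) key i) \<le> 3 * t"
proof -
  \<comment> \<open>Keys encode pairs ordered lexicographically: the time first, and within a time the star before the positions in increasing order.\<close>
  define M where "M = Max (insert 0 J) + 2"
  have M: "Suc p < M" if "p \<in> J" for p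
  proof -
    have "p \<le> Max (insert 0 J)" using that finite_J by simp
    then show ?thesis by (simp add: M_def)
  qed
  have M_pos: "0 < M" by (simp add: M_def)
  define key where "key v = (case v of Path_Vertex p \<Rightarrow> time p * M + Suc p | Star_Vertex a \<Rightarrow> rank a * M)" for v
  have key_simps [simp]: "key (Path_Vertex p) = time p * M + Suc p" "key (Star_Vertex a) = rank a * M" for p a
    by (simp_all add: key_def)
  have key_div: "key (Path_Vertex p) div M = time p" "key (Path_Vertex p) mod M = Suc p" if "p \<in> J" for p
    using M[OF that] M_pos div_mult_self3[of M "time p" "Suc p"] mod_mult_self3[of "time p" M "Suc p"]
    unfolding key_simps by (simp_all only: div_less mod_less add_0_right)
  have "card (sweep_bag (R_graph \<alpha>) (Path_Vertex ` J \<union> Star_Vertex ` S) key i) \<le> 3 * t" for i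
  proof -
    let ?V = "Path_Vertex ` J \<union> Star_Vertex ` S"
    let ?bag = "{v \<in> ?V. key v \<le> i \<and> (key v = i \<or> (\<exists>u \<in> ?V. i \<le> key u \<and> {u, v} \<in> edges_of (R_graph \<alpha>)))}"
    define \<tau> where "\<tau> = i div M"
    define c where "c = i mod M"
    have i: "i = \<tau> * M + c" "c < M" using M_pos by (simp_all add: \<tau>_def c_def)
    \<comment> \<open>The stars that may still wait for a neighbour, and the path vertices that may wait for their successor.\<close>
    define A where "A = {a \<in> S. rank a \<in> {\<tau> + 1 - t..\<tau>}}"
    define P where "P = crossing \<tau> \<union> crossing (Suc \<tau>) \<union> {c - 1, c - 2}"
    have "?bag \<subseteq> Star_Vertex ` A \<union> Path_Vertex ` P"
    proof
      fix v assume v: "v \<in> ?bag"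
      then consider a where "a \<in> S" "v = Star_Vertex a" | p where "p \<in> J" "v = Path_Vertex p" by blast
      then show "v \<in> Star_Vertex ` A \<union> Path_Vertex ` P"
      proof cases
        case (1 a)
        have "rank a * M \<le> i" using v 1 by simp
        then have le: "rank a \<le> \<tau>" using div_le_mono[of "rank a * M" i M] M_pos by (simp add: \<tau>_def)
        have "\<tau> + 1 - t \<le> rank a"
        proof (cases "key v = i")
          case True
          then have "\<tau> = rank a" using 1 M_pos by (auto simp: \<tau>_def)
          then show ?thesis using t_pos by simp
        next
          case False
          then obtain p where p: "p \<in> J" "\<alpha> p = a" "i \<le> key (Path_Vertex p)"
            using v 1 by (auto simp: R_graph_def doubleton_eq_iff)
          then have "\<tau> \<le> time p" using div_le_mono[OF p(3), of M] key_div[OF p(1)] by (simp add: \<tau>_def)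
          then show ?thesis using time_of_letter(2)[OF p(1)] p(2) 1(1) t_pos by auto
        qed
        then show ?thesis using 1 le by (auto simp: A_def)
      next
        case (2 p)
        have key_p: "time p * M + Suc p \<le> i" using v 2 by simp
        have le: "time p \<le> \<tau>" using div_le_mono[of "key v" i M] v 2 key_div by (simp add: \<tau>_def)
        have "p \<in> P"
        proof (cases "key v = i")
          case True
          then have "c = Suc p" using 2 key_div(2)[OF 2(1)] by (simp add: c_def)
          then show ?thesis by (simp add: P_def)
        next
          case False
          then obtain u where u: "u \<in> Path_Vertex ` J \<union> Star_Vertex ` S" "i \<le> key u" "{u, v} \<in> edges_of (R_graph \<alpha>)"
            using v by blast
          then consider "u = Star_Vertex (\<alpha> p)" "\<alpha> p \<in> S" | q where "u = Path_Vertex q" "p = Suc q" "q \<in> J"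
            | "u = Path_Vertex (Suc p)" "Suc p \<in> J"
            using 2 by (auto simp: R_graph_def doubleton_eq_iff)
          then show ?thesis
          proof cases
            case 1
            then have "rank (\<alpha> p) * M \<le> time p * M"
              using time_of_letter(1) \<open>p \<in> J\<close> by (intro mult_le_mono1) simp
            moreover have "i \<le> rank (\<alpha> p) * M" using 1 u(2) by simp
            ultimately have False using key_p by linarith
            then show ?thesis ..
          next
            case (2 q)
            then have "time q \<le> time p" using time_mono same_piece_Suc \<open>p \<in> J\<close> by simp
            then have "time q * M \<le> time p * M" by (rule mult_le_mono1)
            moreover have "i \<le> time q * M + p" using 2 u(2) by simp
            ultimately have False using key_p by linarith
            then show ?thesis ..
          next
            case 3
            \<comment> \<open>The successor comes later: the piece crosses the moment, unless both belong to the current time.\<close>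
            have ge: "\<tau> \<le> time (Suc p)" using div_le_mono[OF u(2), of M]
              unfolding 3(1) \<tau>_def key_div(1)[OF 3(2)] .
            consider "time p < \<tau>" | "time p = \<tau>" "\<tau> < time (Suc p)" | "time p = \<tau>" "time (Suc p) = \<tau>"
              using le ge by linarith
            then show ?thesis
            proof cases
              case 1
              then show ?thesis using ge 2 3 by (simp add: P_def crossing_def)
            next
              case 2
              then show ?thesis using 3 \<open>p \<in> J\<close> by (simp add: P_def crossing_def)
            next
              case same: 3
              then have "Suc p \<le> c" "c \<le> Suc (Suc p)" using key_p u(2) 3 i(1) by auto
              then show ?thesis by (auto simp: P_def)
            qed
          qed
        qed
        then show ?thesis using 2 by simp
      qed
    qed
    moreover have finA: "finite A" using finite_S by (simp add: A_def)
    moreover have finP: "finite P" using finite_crossing by (simp add: P_def)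
    ultimately have "card ?bag \<le> card (Star_Vertex ` A \<union> Path_Vertex ` P)" by (intro card_mono) auto
    also have "\<dots> \<le> card (Star_Vertex ` A) + card (Path_Vertex ` P)" by (rule card_Un_le)
    also have "\<dots> \<le> card A + card P" using card_image_le finA finP by (intro add_mono) auto
    also have "\<dots> \<le> 3 * t"
    proof -
      have "card A = card (rank ` A)"
        using rank_inj by (intro card_image[symmetric]) (auto simp: A_def inj_on_def)
      also have "\<dots> \<le> card {\<tau> + 1 - t..\<tau>}" by (intro card_mono) (auto simp: A_def)
      finally have "card A \<le> t" by simp
      moreover have "card P \<le> card (crossing \<tau>) + card (crossing (Suc \<tau>)) + card {c - 1, c - 2}"
        unfolding P_def by (meson add_le_mono1 card_Un_le order_trans)
      moreover have "card {c - 1, c - 2} \<le> 2" by (simp add: card_insert_if)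
      ultimately show ?thesis using card_crossing[of \<tau>] card_crossing[of "Suc \<tau>"] by linarith
    qed
    finally show ?thesis unfolding sweep_bag_def .
  qed
  then show ?thesis by blast
qed

end

section \<open>Nested words\<close>

text \<open>The branches of a subset \<open>S\<close> are forced to be the traces on \<open>S\<close>, without its base, of the
branches of \<open>\<alpha>\<close>. Of the branching condition only this is kept: a letter outside the base that
is read directly after a letter outside the base is its successor in a branch.\<close>

lemma nested_with_base:
  assumes "nested_with b \<alpha> A B H" "S \<subseteq> A"
  shows "\<exists>base. base \<subseteq> S \<and> finite base \<and> card base \<le> b \<and>
    (\<forall>x y. x < y \<longrightarrow> \<alpha> x \<in> S - base \<longrightarrow> \<alpha> y \<in> S - base \<longrightarrow> (\<forall>z. x < z \<and> z < y \<longrightarrow> \<alpha> z \<notin> S) \<longrightarrow>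
       (\<exists>i. precedes_in ((S - base) \<inter> H i) (\<alpha> x) (\<alpha> y)))"
proof -
  obtain BS HS where BS: "card BS \<le> b"
    and br: "branched_word (keep_letters S (Inf_Word \<alpha>)) S BS HS" and HS: "\<And>i. HS i \<subseteq> H i"
    using assms unfolding nested_with_def by blast
  have disj: "disjoint_family H"
    using assms(1) by (simp add: nested_with_def branched_word_def base_branch_partition_def)
  have S_eq: "S = BS \<union> (\<Union>i. HS i)" and BS_HS: "\<And>i. BS \<inter> HS i = {}" and "finite BS"
    using br by (simp_all add: branched_word_def base_branch_partition_def)
  have HS_eq: "HS i = (S - BS) \<inter> H i" for i
  proof
    show "HS i \<subseteq> (S - BS) \<inter> H i" using S_eq BS_HS HS by blast
    show "(S - BS) \<inter> H i \<subseteq> HS i"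
    proof
      fix c assume c: "c \<in> (S - BS) \<inter> H i"
      then obtain j where "c \<in> HS j" using S_eq by blast
      then have "c \<in> H j \<inter> H i" using c HS by blast
      then have "j = i" using disj unfolding disjoint_family_on_def by blast
      then show "c \<in> HS i" using \<open>c \<in> HS j\<close> by simp
    qed
  qed
  have "\<exists>i. precedes_in ((S - BS) \<inter> H i) (\<alpha> x) (\<alpha> y)"
    if xy: "x < y" "\<alpha> x \<in> S - BS" "\<alpha> y \<in> S - BS" "\<And>z. x < z \<Longrightarrow> z < y \<Longrightarrow> \<alpha> z \<notin> S" for x y
  proof -
    define X where "X = {j. \<alpha> j \<in> S}"
    have "infinite {j. \<alpha> j = \<alpha> x}" using assms xy(2) unfolding nested_with_def by blast
    then have inf: "infinite X" by (rule contrapos_nn) (use xy(2) in \<open>auto simp: X_def elim: rev_finite_subset\<close>)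
    then have word: "keep_letters S (Inf_Word \<alpha>) = Inf_Word (\<lambda>n. \<alpha> (enumerate X n))"
      by (simp add: X_def)
    \<comment> \<open>Consecutive positions of letters of \<open>S\<close> are consecutive in the enumeration of these positions.\<close>
    obtain n where n: "enumerate X n = x" using enumerate_Ex[OF inf, of x] xy(2) by (auto simp: X_def)
    have "enumerate X (Suc n) = (LEAST s. s \<in> X \<and> enumerate X n < s)" by (rule enumerate_Suc''[OF inf])
    also have "\<dots> = y"
    proof (rule Least_equality)
      show "y \<in> X \<and> enumerate X n < y" using xy n by (simp add: X_def)
      show "y \<le> z" if "z \<in> X \<and> enumerate X n < z" for z
        using that xy(4)[of z] n by (auto simp: X_def not_less[symmetric])
    qed
    finally have Suc_n: "enumerate X (Suc n) = y" .
    obtain i where i: "\<alpha> y \<in> HS i" using xy(3) S_eq by blast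
    let ?w = "Inf_Word (\<lambda>n. \<alpha> (enumerate X n))"
    have succ_rule: "enat j < word_length ?w \<and> letter ?w j \<in> HS i \<longrightarrow>
        (if first_letter_of (HS i) (letter ?w j) then j = 0 \<or> letter ?w (j - 1) \<in> BS
         else j > 0 \<and> precedes_in (HS i) (letter ?w (j - 1)) (letter ?w j))" for i j
      using br unfolding branched_word_def word by (elim conjE allE)
    have "if first_letter_of (HS i) (\<alpha> y) then \<alpha> x \<in> BS else precedes_in (HS i) (\<alpha> x) (\<alpha> y)"
      using succ_rule[of "Suc n" i] i n Suc_n by (simp split: if_splits)
    then have "precedes_in (HS i) (\<alpha> x) (\<alpha> y)" using xy(2) by (auto split: if_splits)
    then show ?thesis unfolding HS_eq by blast
  qed
  then show ?thesis using BS \<open>finite BS\<close> S_eq by (intro exI[of _ BS]) blast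
qed

text \<open>Without base letters the word cannot leave a branch, and it reads every letter of the branch
that it passes. Hence, if it reads two letters of a subset \<open>T\<close> and none of \<open>T\<close> in between,
there is no letter of \<open>T\<close> between them in the branch either: being consecutive in a branch is
inherited by subsets. This is what makes it possible to delete base letters repeatedly.\<close>

lemma run_within_branch:
  fixes \<alpha> :: "nat \<Rightarrow> nat"
  assumes disj: "disjoint_family H"
    and step: "\<And>x y. x < y \<Longrightarrow> \<alpha> x \<in> S - base \<Longrightarrow> \<alpha> y \<in> S - base \<Longrightarrow>
       (\<And>z. x < z \<Longrightarrow> z < y \<Longrightarrow> \<alpha> z \<notin> S) \<Longrightarrow> \<exists>i. precedes_in ((S - base) \<inter> H i) (\<alpha> x) (\<alpha> y)"
    and T: "T \<subseteq> S - base"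
    and xy: "x < y" "\<alpha> x \<in> T" "\<alpha> y \<in> T"
    and avoid: "\<And>z. z \<in> {x..y} \<Longrightarrow> \<alpha> z \<notin> base"
    and between: "\<And>z. x < z \<Longrightarrow> z < y \<Longrightarrow> \<alpha> z \<notin> T"
  shows "\<exists>i. precedes_in (T \<inter> H i) (\<alpha> x) (\<alpha> y)"
proof -
  \<comment> \<open>Every letter outside the base that lies between the two in the branch is read on the way.\<close>
  have claim: "\<exists>i. \<alpha> x \<in> H i \<and> \<alpha> y \<in> H i \<and> \<alpha> x < \<alpha> y \<and>
      (\<forall>c \<in> (S - base) \<inter> H i. \<alpha> x < c \<and> c < \<alpha> y \<longrightarrow> (\<exists>z. x < z \<and> z < y \<and> \<alpha> z = c))"
    if "x < y" "\<alpha> x \<in> S - base" "\<alpha> y \<in> S - base" "\<forall>z\<in>{x..y}. \<alpha> z \<notin> base" for x y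
    using that
  proof (induction "y - x" arbitrary: x y rule: less_induct)
    case less
    show ?case
    proof (cases "\<exists>z. x < z \<and> z < y \<and> \<alpha> z \<in> S")
      case False
      then obtain i where "precedes_in ((S - base) \<inter> H i) (\<alpha> x) (\<alpha> y)"
        using step[of x y] less.prems by blast
      then show ?thesis unfolding precedes_in_def by blast
    next
      case True
      then obtain z where z: "x < z" "z < y" "\<alpha> z \<in> S" by blast
      then have zU: "\<alpha> z \<in> S - base" using less.prems(4) by simp
      have "\<forall>u\<in>{x..z}. \<alpha> u \<notin> base" "\<forall>u\<in>{z..y}. \<alpha> u \<notin> base" using less.prems(4) z by simp_all
      moreover have "z - x < y - x" "y - z < y - x" using z by simp_all
      ultimately obtain i j where
        i: "\<alpha> x \<in> H i" "\<alpha> z \<in> H i" "\<alpha> x < \<alpha> z"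
          "\<And>c. c \<in> (S - base) \<inter> H i \<Longrightarrow> \<alpha> x < c \<Longrightarrow> c < \<alpha> z \<Longrightarrow> \<exists>u. x < u \<and> u < z \<and> \<alpha> u = c" and
        j: "\<alpha> z \<in> H j" "\<alpha> y \<in> H j" "\<alpha> z < \<alpha> y"
          "\<And>c. c \<in> (S - base) \<inter> H j \<Longrightarrow> \<alpha> z < c \<Longrightarrow> c < \<alpha> y \<Longrightarrow> \<exists>u. z < u \<and> u < y \<and> \<alpha> u = c"
        using less.hyps[of z x] less.hyps[of y z] less.prems(2,3) z(1,2) zU by metis
      have "i = j" using i(2) j(1) disj by (auto simp: disjoint_family_on_def)
      have "\<exists>u. x < u \<and> u < y \<and> \<alpha> u = c" if c: "c \<in> (S - base) \<inter> H i" "\<alpha> x < c" "c < \<alpha> y" for c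
      proof (cases c "\<alpha> z" rule: linorder_cases)
        case less
        then show ?thesis using i(4)[OF c(1,2)] z(2) by (meson less_trans)
      next
        case equal
        then show ?thesis using z by blast
      next
        case greater
        then show ?thesis using j(4)[of c] c \<open>i = j\<close> z(1) by (meson less_trans)
      qed
      moreover have "\<alpha> x < \<alpha> y" using i(3) j(3) by simp
      ultimately show ?thesis using i(1) j(2) \<open>i = j\<close> by blast
    qed
  qed
  obtain i where i: "\<alpha> x \<in> H i" "\<alpha> y \<in> H i" "\<alpha> x < \<alpha> y"
    "\<And>c. c \<in> (S - base) \<inter> H i \<Longrightarrow> \<alpha> x < c \<Longrightarrow> c < \<alpha> y \<Longrightarrow> \<exists>z. x < z \<and> z < y \<and> \<alpha> z = c"
    using claim[OF xy(1)] xy T avoid by blast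
  have "\<not> (\<exists>c\<in>T \<inter> H i. \<alpha> x < c \<and> c < \<alpha> y)"
  proof
    assume "\<exists>c\<in>T \<inter> H i. \<alpha> x < c \<and> c < \<alpha> y"
    then obtain c where c: "c \<in> T" "c \<in> H i" "\<alpha> x < c" "c < \<alpha> y" by blast
    then obtain z where "x < z" "z < y" "\<alpha> z = c" using i(4)[of c] T by blast
    then show False using between c(1) by blast
  qed
  then show ?thesis using i xy unfolding precedes_in_def by blast
qed

text \<open>Listing the branches one after the other gives consecutive ranks to consecutive letters of a
branch, so that all branches can be swept as if they were one.\<close>

lemma branch_rank_exists:
  fixes H :: "nat \<Rightarrow> nat set"
  assumes fin: "finite S" and disj: "disjoint_family H"
  obtains rank :: "nat \<Rightarrow> nat" where "inj_on rank S"
    "\<And>i a c. precedes_in (S \<inter> H i) a c \<Longrightarrow> rank c = Suc (rank a)"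
proof -
  define br where "br a = (if \<exists>i. a \<in> H i then Suc (THE i. a \<in> H i) else 0)" for a
  have br: "a \<in> H i \<longleftrightarrow> br a = Suc i" for a i
  proof -
    have "(THE i. a \<in> H i) = j" if "a \<in> H j" for j
      using that disj by (intro the_equality) (auto simp: disjoint_family_on_def)
    then show ?thesis unfolding br_def by (auto split: if_splits)
  qed
  \<comment> \<open>The rank of a letter is its place in the lexicographic order by branch and letter.\<close>
  define below where "below a = {c \<in> S. br c < br a \<or> br c = br a \<and> c < a}" for a
  have fin_below: "finite (below a)" for a using fin by (simp add: below_def)
  have less: "card (below a) < card (below c)" if "a \<in> S" "br a < br c \<or> br a = br c \<and> a < c" for a c
  proof (rule psubset_card_mono[OF fin_below])
    have "below a \<subseteq> below c" using that(2) unfolding below_def by auto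
    moreover have "a \<in> below c" "a \<notin> below a" using that by (simp_all add: below_def)
    ultimately show "below a \<subset> below c" by blast
  qed
  have "inj_on (\<lambda>a. card (below a)) S"
  proof (rule inj_onI, rule ccontr)
    fix a c assume "a \<in> S" "c \<in> S" "card (below a) = card (below c)" "a \<noteq> c"
    then show False
      using less[of a c] less[of c a]
      by (cases "br a" "br c" rule: linorder_cases; cases a c rule: linorder_cases) auto
  qed
  moreover have "card (below c) = Suc (card (below a))" if "precedes_in (S \<inter> H i) a c" for i a c
  proof -
    have ac: "a \<in> S" "br a = Suc i" "br c = Suc i" "a < c"
      "\<And>z. z \<in> S \<Longrightarrow> br z = Suc i \<Longrightarrow> a < z \<Longrightarrow> z < c \<Longrightarrow> False"
      using that unfolding precedes_in_def br[symmetric] by blast+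
    have "below c = insert a (below a)"
    proof (rule set_eqI)
      fix z show "z \<in> below c \<longleftrightarrow> z \<in> insert a (below a)"
        using ac(1-4) ac(5)[of z] unfolding below_def by (cases z a rule: linorder_cases) auto
    qed
    moreover have "a \<notin> below a" by (simp add: below_def)
    ultimately show ?thesis using fin_below by simp
  qed
  ultimately show ?thesis using that[of "\<lambda>a. card (below a)"] by blast
qed

section \<open>Sails in path-star classes of nested words\<close>

lemma R_graph_edges:
  "{Path_Vertex i, Path_Vertex j} \<in> edges_of (R_graph \<alpha>) \<longleftrightarrow> j = Suc i \<or> i = Suc j"
  "{Path_Vertex i, Star_Vertex a} \<in> edges_of (R_graph \<alpha>) \<longleftrightarrow> \<alpha> i = a"
  "{Star_Vertex a, Star_Vertex c} \<notin> edges_of (R_graph \<alpha>)"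
  by (auto simp: R_graph_def doubleton_eq_iff)

text \<open>The bound is the size of the deleted set, at most \<open>2 * Suc (t * b ^ t)\<close> positions and \<open>t\<close>
base sets of at most \<open>b\<close> letters, plus the bags of the sweep.\<close>

lemma sail_or_bounded_tree_width:
  fixes G :: "'a ugraph" and \<alpha> :: "nat \<Rightarrow> nat"
  assumes nested: "nested_with b \<alpha> A B H" and G: "G \<in> path_star_class \<alpha>" and t: "1 \<le> t"
    and no_sail: "\<not> has_induced_sail t G"
  shows "tree_width G \<le> 2 * Suc (t * b ^ t) + t * b + 3 * t"
proof -
  have letters: "\<alpha> j \<in> A" for j
    using nested by (simp add: nested_with_def branched_word_def word_over_def)
  have H_sub: "H i \<subseteq> A" for i
    using nested by (auto simp: nested_with_def branched_word_def base_branch_partition_def)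
  have disj: "disjoint_family H"
    using nested by (simp add: nested_with_def branched_word_def base_branch_partition_def)
  have fin_G: "finite_graph G" and simple: "simple_graph G"
    using G by (auto simp: path_star_class_def finite_graph_def)
  obtain W h where W: "finite W" "W \<subseteq> verts_of (R_graph \<alpha>)"
    and h_bij: "bij_betw h (verts_of G) W"
    and h_edge: "\<And>u v. u \<in> verts_of G \<Longrightarrow> v \<in> verts_of G \<Longrightarrow>
      {u, v} \<in> edges_of G \<longleftrightarrow> {h u, h v} \<in> edges_of (induced (R_graph \<alpha>) W)"
    using G by (auto simp: path_star_class_def graph_iso_def induced_def)
  have h_mem: "h u \<in> W" if "u \<in> verts_of G" for u using bij_betw_apply[OF h_bij that] .
  have h_edge': "{u, v} \<in> edges_of G \<longleftrightarrow> {h u, h v} \<in> edges_of (R_graph \<alpha>)"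
    if "u \<in> verts_of G" "v \<in> verts_of G" for u v
    using h_edge[OF that] h_mem that by (simp add: induced_def)
  define g where "g = inv_into (verts_of G) h"
  have g_mem: "g x \<in> verts_of G" if "x \<in> W" for x
    unfolding g_def using that bij_betw_imp_surj_on[OF h_bij] by (intro inv_into_into) simp
  have hg: "h (g x) = x" if "x \<in> W" for x
    unfolding g_def using that bij_betw_imp_surj_on[OF h_bij] by (intro f_inv_into_f) simp
  have gh: "g (h u) = u" if "u \<in> verts_of G" for u
    using bij_betw_inv_into_left[OF h_bij that] by (simp add: g_def)
  have g_inj: "inj_on g W" using hg by (metis inj_onI)
  have g_edge: "{g x, g y} \<in> edges_of G \<longleftrightarrow> {x, y} \<in> edges_of (R_graph \<alpha>)" if "x \<in> W" "y \<in> W" for x y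
    using h_edge'[OF g_mem[OF that(1)] g_mem[OF that(2)]] hg that by simp
  define J where "J = {j. Path_Vertex j \<in> W}"
  define S where "S = {a. Star_Vertex a \<in> W}"
  have W_eq: "W = Path_Vertex ` J \<union> Star_Vertex ` S"
  proof
    show "W \<subseteq> Path_Vertex ` J \<union> Star_Vertex ` S"
    proof
      fix x assume "x \<in> W"
      then show "x \<in> Path_Vertex ` J \<union> Star_Vertex ` S"
        unfolding J_def S_def by (cases x) simp_all
    qed
  qed (auto simp: J_def S_def)
  have "finite (Path_Vertex ` J)" "finite (Star_Vertex ` S)"
    using W(1) unfolding W_eq by simp_all
  then have fin_J: "finite J" and fin_S: "finite S"
    by (auto elim!: finite_imageD simp: inj_on_def)
  \<comment> \<open>The only way in which the absence of sails is used.\<close>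
  have no_cover: False
    if F: "finite F" "card F = t" "separated_intervals F" "\<And>I. I \<in> F \<Longrightarrow> {fst I..snd I} \<subseteq> J"
      and T: "T \<subseteq> S" "finite T" "card T = t" "\<And>I. I \<in> F \<Longrightarrow> T \<subseteq> \<alpha> ` {fst I..snd I}" for F T
  proof -
    let ?Q = "\<Union>I\<in>F. {fst I..snd I}"
    have Q: "Path_Vertex i \<in> W" if "i \<in> ?Q" for i using that F(4) unfolding J_def by blast
    have TW: "Star_Vertex a \<in> W" if "a \<in> T" for a using that T(1) unfolding S_def by blast
    have "has_induced_sail t G"
    proof (rule separated_intervals_give_sail[OF simple, where F = F and T = T and \<alpha> = \<alpha>
          and p = "\<lambda>j. g (Path_Vertex j)" and s = "\<lambda>a. g (Star_Vertex a)"])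
      show "(\<lambda>j. g (Path_Vertex j)) ` ?Q \<union> (\<lambda>a. g (Star_Vertex a)) ` T \<subseteq> verts_of G"
        using Q TW g_mem by (intro Un_least image_subsetI) simp_all
      show "inj_on (\<lambda>j. g (Path_Vertex j)) ?Q"
        using Q inj_onD[OF g_inj] by (intro inj_onI) blast
      show "inj_on (\<lambda>a. g (Star_Vertex a)) T"
        using TW inj_onD[OF g_inj] by (intro inj_onI) blast
      show "(\<lambda>j. g (Path_Vertex j)) ` ?Q \<inter> (\<lambda>a. g (Star_Vertex a)) ` T = {}"
      proof (rule equals0I)
        fix x assume "x \<in> (\<lambda>j. g (Path_Vertex j)) ` ?Q \<inter> (\<lambda>a. g (Star_Vertex a)) ` T"
        then obtain j a where "j \<in> ?Q" "a \<in> T" "g (Path_Vertex j) = g (Star_Vertex a)"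
          by (elim IntE imageE) simp
        then show False using inj_onD[OF g_inj _ Q TW] by blast
      qed
      show "{g (Path_Vertex i), g (Path_Vertex j)} \<in> edges_of G \<longleftrightarrow> j = Suc i \<or> i = Suc j"
        if "i \<in> ?Q" "j \<in> ?Q" for i j
        unfolding g_edge[OF Q[OF that(1)] Q[OF that(2)]] by (rule R_graph_edges)
      show "{g (Path_Vertex i), g (Star_Vertex a)} \<in> edges_of G \<longleftrightarrow> \<alpha> i = a"
        if "i \<in> ?Q" "a \<in> T" for i a
        unfolding g_edge[OF Q[OF that(1)] TW[OF that(2)]] by (rule R_graph_edges)
      show "{g (Star_Vertex a), g (Star_Vertex c)} \<notin> edges_of G" if "a \<in> T" "c \<in> T" for a c
        unfolding g_edge[OF TW[OF that(1)] TW[OF that(2)]] by (rule R_graph_edges)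
    qed (use F T in simp_all)
    then show False using no_sail by blast
  qed
  obtain base where base: "\<And>S'. S' \<subseteq> A \<Longrightarrow> base S' \<subseteq> S' \<and> finite (base S') \<and> card (base S') \<le> b"
    and base_run: "\<And>S' x y. S' \<subseteq> A \<Longrightarrow> x < y \<Longrightarrow> \<alpha> x \<in> S' - base S' \<Longrightarrow> \<alpha> y \<in> S' - base S' \<Longrightarrow>
      (\<And>z. x < z \<Longrightarrow> z < y \<Longrightarrow> \<alpha> z \<notin> S') \<Longrightarrow> \<exists>i. precedes_in ((S' - base S') \<inter> H i) (\<alpha> x) (\<alpha> y)"
  proof -
    from nested_with_base[OF nested]
    obtain base where base: "\<forall>S'. S' \<subseteq> A \<longrightarrow> (base S' \<subseteq> S' \<and> finite (base S') \<and> card (base S') \<le> b \<and>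
      (\<forall>x y. x < y \<longrightarrow> \<alpha> x \<in> S' - base S' \<longrightarrow> \<alpha> y \<in> S' - base S' \<longrightarrow> (\<forall>z. x < z \<and> z < y \<longrightarrow> \<alpha> z \<notin> S') \<longrightarrow>
       (\<exists>i. precedes_in ((S' - base S') \<inter> H i) (\<alpha> x) (\<alpha> y))))" by metis
    show thesis by (rule that[of base]) (use base in simp_all)
  qed
  \<comment> \<open>\<open>K k\<close> is the base of what remains of the star letters after deleting the bases \<open>K 0, ..., K (k - 1)\<close>. Star letters outside \<open>A\<close> are never read; their vertices are isolated.\<close>
  define L where "L k = ((\<lambda>S'. S' - base S') ^^ k) (S \<inter> A)" for k
  define K where "K k = base (L k)" for k
  have L_0: "L 0 = S \<inter> A" and L_Suc: "L (Suc k) = L k - K k" for k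
    by (simp_all add: L_def K_def)
  have L_dec: "L l \<subseteq> L k" if "k \<le> l" for k l
    using that by (induction l rule: dec_induct) (auto simp: L_Suc)
  have L_sub: "L k \<subseteq> S \<inter> A" for k using L_dec[of 0 k] L_0 by simp
  have K: "K k \<subseteq> L k" "finite (K k)" "card (K k) \<le> b" for k
    using base[of "L k"] L_sub[of k] by (simp_all add: K_def)
  have K_disj: "K k \<inter> K l = {}" if "k \<noteq> l" for k l
  proof -
    have "K k \<inter> K l = {}" if "k < l" for k l
      using K(1)[of l] L_dec[of "Suc k" l] L_Suc[of k] that by auto
    then show ?thesis using that by (cases k l rule: linorder_cases) auto
  qed
  \<comment> \<open>A full interval meets a letter of every base, so \<open>t\<close> full intervals that meet the same letters form a sail.\<close>
  define full where "full x y \<longleftrightarrow> (\<forall>k<t. \<exists>j\<in>{x..y}. \<alpha> j \<in> K k)" for x y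
  have "\<not> (\<exists>F. finite F \<and> card F = Suc (t * b ^ t) \<and> separated_intervals F \<and>
            (\<forall>I\<in>F. {fst I..snd I} \<subseteq> J \<and> full (fst I) (snd I)))"
  proof
    assume "\<exists>F. finite F \<and> card F = Suc (t * b ^ t) \<and> separated_intervals F \<and>
            (\<forall>I\<in>F. {fst I..snd I} \<subseteq> J \<and> full (fst I) (snd I))"
    then obtain F where F: "finite F" "card F = Suc (t * b ^ t)" "separated_intervals F"
      "\<And>I. I \<in> F \<Longrightarrow> {fst I..snd I} \<subseteq> J" "\<And>I. I \<in> F \<Longrightarrow> full (fst I) (snd I)" by blast
    obtain F' T where F'T: "F' \<subseteq> F" "card F' = t" "T \<subseteq> (\<Union>k<t. K k)" "finite T" "card T = t"
      "\<And>I. I \<in> F' \<Longrightarrow> T \<subseteq> \<alpha> ` {fst I..snd I}"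
      by (rule common_transversal[of t K b F \<alpha>]) (use K(2,3) K_disj F in \<open>simp_all add: full_def\<close>)
    have "T \<subseteq> S" using F'T(3) K(1) L_sub by blast
    then show False
      using no_cover[of F' T] F'T F(4) finite_subset[OF F'T(1) F(1)] separated_intervals_subset[OF F(3) F'T(1)]
      by (meson subsetD)
  qed
  then obtain D where D: "D \<subseteq> J" "card D \<le> 2 * Suc (t * b ^ t)"
    "\<And>x y. x \<le> y \<Longrightarrow> {x..y} \<subseteq> J - D \<Longrightarrow> \<not> full x y"
    using separated_intervals_or_hitting_set[OF fin_J, of "Suc (t * b ^ t)" full] by blast
  let ?K = "\<Union>k<t. K k"
  let ?J = "J - D" and ?S = "S - ?K"
  have T_sub: "?S \<inter> A \<subseteq> L k" if "k \<le> t" for k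
    using that by (induction k) (auto simp: L_0 L_Suc)
  obtain rank where rank: "inj_on rank ?S" "\<And>i a c. precedes_in (?S \<inter> H i) a c \<Longrightarrow> rank c = Suc (rank a)"
    using branch_rank_exists[of ?S H] fin_S disj by blast
  interpret ranked_runs \<alpha> ?J ?S rank t
  proof
    show "finite ?J" "finite ?S" "inj_on rank ?S" "1 \<le> t" using fin_J fin_S rank t by simp_all
  next
    fix x y assume xy: "x < y" "{x..y} \<subseteq> ?J" "\<alpha> x \<in> ?S" "\<alpha> y \<in> ?S"
      and between: "\<And>z. x < z \<Longrightarrow> z < y \<Longrightarrow> \<alpha> z \<notin> ?S"
    \<comment> \<open>A piece of the remaining path is not full, so it avoids some base \<open>K k\<close> and reads a run of the letters left.\<close>
    obtain k where k: "k < t" "\<And>z. z \<in> {x..y} \<Longrightarrow> \<alpha> z \<notin> K k"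
      using D(3)[of x y] xy(1,2) unfolding full_def by auto
    have "\<exists>i. precedes_in ((?S \<inter> A) \<inter> H i) (\<alpha> x) (\<alpha> y)"
    proof (rule run_within_branch[OF disj, where \<alpha> = \<alpha> and x = x and y = y and S = "L k" and base = "K k"])
      show "\<exists>i. precedes_in ((L k - K k) \<inter> H i) (\<alpha> x) (\<alpha> y)"
        if "x < y" "\<alpha> x \<in> L k - K k" "\<alpha> y \<in> L k - K k" "\<And>z. x < z \<Longrightarrow> z < y \<Longrightarrow> \<alpha> z \<notin> L k" for x y
        using base_run[of "L k" x y] that L_sub[of k] unfolding K_def by auto
      show "?S \<inter> A \<subseteq> L k - K k" using T_sub[of k] k(1) by auto
    qed (use xy letters k(2) between in auto)
    moreover have "(?S \<inter> A) \<inter> H i = ?S \<inter> H i" for i using H_sub by blast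
    ultimately show "rank (\<alpha> y) = Suc (rank (\<alpha> x))" using rank(2) by auto
  next
    fix F w
    assume F: "finite F" "card F = t" "separated_intervals F" "\<And>I. I \<in> F \<Longrightarrow> {fst I..snd I} \<subseteq> ?J"
      and win: "\<And>I. I \<in> F \<Longrightarrow> {w..<w + t} \<subseteq> rank ` (\<alpha> ` {fst I..snd I} \<inter> ?S)"
    \<comment> \<open>The letters with ranks in the covered window are common neighbours of the \<open>t\<close> intervals.\<close>
    define T where "T = {a \<in> ?S. rank a \<in> {w..<w + t}}"
    have cover: "T \<subseteq> \<alpha> ` {fst I..snd I}" if I: "I \<in> F" for I
    proof
      fix a assume a: "a \<in> T"
      then have "rank a \<in> rank ` (\<alpha> ` {fst I..snd I} \<inter> ?S)"
        using subsetD[OF win[OF I]] by (simp add: T_def)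
      then obtain c where c: "c \<in> \<alpha> ` {fst I..snd I}" "c \<in> ?S" "rank a = rank c"
        by blast
      have "a \<in> ?S" using a by (simp add: T_def)
      then have "a = c" using inj_onD[OF rank(1) c(3)] c(2) by simp
      then show "a \<in> \<alpha> ` {fst I..snd I}" using c(1) by simp
    qed
    have "F \<noteq> {}" using F(2) t by force
    then obtain I where "I \<in> F" by blast
    have "rank ` T = {w..<w + t}"
    proof
      show "rank ` T \<subseteq> {w..<w + t}" unfolding T_def by blast
      have "{w..<w + t} \<subseteq> rank ` ?S" using win[OF \<open>I \<in> F\<close>] by blast
      then show "{w..<w + t} \<subseteq> rank ` T" unfolding T_def by blast
    qed
    moreover have "inj_on rank T" by (rule inj_on_subset[OF rank(1)]) (auto simp: T_def)
    ultimately have "card T = t" using card_image[of rank T] by simp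
    moreover have "T \<subseteq> S" "finite T" using fin_S by (auto simp: T_def)
    moreover have "{fst I..snd I} \<subseteq> J" if "I \<in> F" for I using F(4)[OF that] by blast
    ultimately show False using no_cover[OF F(1,2,3)] cover by blast
  qed
  let ?R = "Path_Vertex ` ?J \<union> Star_Vertex ` ?S"
  obtain key where key: "\<forall>i. card (sweep_bag (R_graph \<alpha>) ?R key i) \<le> 3 * t"
    using sweep_key_exists by (rule exE)
  define Z where "Z = g ` (Path_Vertex ` D \<union> Star_Vertex ` ?K)"
  have K_S: "?K \<subseteq> S" using K(1) L_sub by blast
  have Z_W: "Path_Vertex ` D \<union> Star_Vertex ` ?K \<subseteq> W" using D(1) K_S unfolding W_eq by (intro Un_mono image_mono)
  have Z_sub: "Z \<subseteq> verts_of G" unfolding Z_def by (intro image_subsetI g_mem subsetD[OF Z_W])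
  have fin_D: "finite D" using D(1) fin_J by (rule finite_subset)
  have h_R: "h v \<in> ?R" if "v \<in> verts_of G - Z" for v
  proof -
    have "h v \<notin> Path_Vertex ` D \<union> Star_Vertex ` ?K"
    proof
      assume "h v \<in> Path_Vertex ` D \<union> Star_Vertex ` ?K"
      then have "g (h v) \<in> Z" unfolding Z_def by (rule imageI)
      then show False using gh that by simp
    qed
    moreover have "h v \<in> Path_Vertex ` J \<union> Star_Vertex ` S" using h_mem that unfolding W_eq by simp
    ultimately show ?thesis by (cases "h v") (simp_all add: image_iff)
  qed
  have "tree_width G \<le> card Z + 3 * t"
  proof (rule tree_width_le_by_sweep[OF fin_G Z_sub, where key = "\<lambda>v. key (h v)"])
    fix i
    let ?bG = "sweep_bag G (verts_of G - Z) (\<lambda>v. key (h v)) i"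
    let ?bR = "sweep_bag (R_graph \<alpha>) ?R key i"
    have "h ` ?bG \<subseteq> ?bR"
    proof (rule image_subsetI)
      fix v assume v: "v \<in> ?bG"
      have "\<exists>u \<in> ?R. i \<le> key u \<and> {u, h v} \<in> edges_of (R_graph \<alpha>)" if ne: "key (h v) \<noteq> i"
      proof -
        obtain u where u: "u \<in> verts_of G - Z" "i \<le> key (h u)" "{u, v} \<in> edges_of G"
          using v ne unfolding sweep_bag_def by blast
        then have "{h u, h v} \<in> edges_of (R_graph \<alpha>)" using h_edge'[of u v] v by (simp add: sweep_bag_def)
        then show ?thesis using h_R[OF u(1)] u(2) by (intro bexI[of _ "h u"] conjI)
      qed
      moreover have "h v \<in> ?R" using h_R v by (simp add: sweep_bag_def)
      moreover have "key (h v) \<le> i" using v by (simp add: sweep_bag_def)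
      ultimately show "h v \<in> ?bR" unfolding sweep_bag_def disj_imp by (intro CollectI conjI impI)
    qed
    moreover have "inj_on h ?bG"
      using bij_betw_imp_inj_on[OF h_bij] by (rule inj_on_subset) (rule subsetI, simp add: sweep_bag_def)
    moreover have "finite ?bR" using fin_J fin_S by (simp add: sweep_bag_def)
    ultimately have "card ?bG \<le> card ?bR" by (intro card_inj_on_le[of h])
    then show "card ?bG \<le> 3 * t" using spec[OF key, of i] by (rule order_trans)
  qed
  also have "card Z \<le> 2 * Suc (t * b ^ t) + t * b"
  proof -
    have fin_K: "finite ?K" using K(2) by simp
    have "card ?K \<le> (\<Sum>k<t. card (K k))" by (intro card_UN_le) simp
    also have "\<dots> \<le> t * b" using sum_bounded_above[of "{..<t}" "\<lambda>k. card (K k)" b] K(3) by simp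
    finally have card_K: "card ?K \<le> t * b" .
    have "card Z \<le> card (Path_Vertex ` D \<union> Star_Vertex ` ?K)"
      unfolding Z_def using fin_D fin_K by (intro card_image_le) simp
    also have "\<dots> \<le> card (Path_Vertex ` D) + card (Star_Vertex ` ?K)" by (rule card_Un_le)
    also have "\<dots> \<le> card D + card ?K" using fin_D fin_K by (intro add_mono card_image_le) simp_all
    finally show ?thesis using D(2) card_K by linarith
  qed
  finally show ?thesis by simp
qed

theorem theorem5p9:
  fixes \<alpha> :: "nat \<Rightarrow> nat"
  assumes "nested_word \<alpha>"
  shows "\<forall>t::nat\<ge>1. \<exists>f::nat\<ge>1. \<forall>G::nat ugraph \<in> path_star_class \<alpha>.
           tree_width G \<ge> f \<longrightarrow> has_induced_sail t G"
proof (intro allI impI)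
  fix t :: nat assume t: "1 \<le> t"
  obtain b A B H where nested: "nested_with b \<alpha> A B H"
    using assms unfolding nested_word_def by blast
  let ?f = "Suc (2 * Suc (t * b ^ t) + t * b + 3 * t)"
  have "\<forall>G::nat ugraph \<in> path_star_class \<alpha>. ?f \<le> tree_width G \<longrightarrow> has_induced_sail t G"
    using sail_or_bounded_tree_width[OF nested _ t] by (meson Suc_n_not_le_n le_trans)
  then show "\<exists>f\<ge>1. \<forall>G::nat ugraph \<in> path_star_class \<alpha>. f \<le> tree_width G \<longrightarrow> has_induced_sail t G"
    by (intro exI[of _ ?f]) simp
qed

end
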